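(* Let $\Delta$ be a thick polar space of rank $3$. Let $d,q$ be two distinct collinear points of $\Delta$, and let $m,m'$ be two distinct collinear points of $\Delta$ not collinear to $q$, but such that $d\in mm'$. Let $\eta$ be the unique permutation of $d^\perp\cup q^\perp$ such that: (i) $\eta(m)=m'$; (ii) $\eta$ fixes all points of $d^\perp\cap q^\perp$; (iii) in each plane $\pi$ containing $d$ or $q$, but not both, $\eta$ induces a translation of $\pi$ with axis $\mathrm{proj}_\pi(dq)$ and center $d$ or $q$, respectively; (iv) $\eta$ preserves collinearity. For opposite points $p,b$ with $d,q\in p^\perp\cap b^\perp$, let $\eta_{p,b}$ be the unique root elation of the generalized quadrangle $p^\perp\cap b^\perp$ corresponding to the root $(d,dq,q)$ that has the same action as $\eta$ on the points of $p^\perp\cap b^\perp$ collinear to $q$ or $d$. Then the map $\phi:\Delta\to\Delta$ defined on points by $$\phi(x):=\begin{cases} x, & \text{if } x \text{ is in a plane with } dq,\\ \eta(x), & \text{if } x\perp q \text{ or } x\perp d,\ x \text{ not in a plane with } dq,\\ \eta_{p,b}(x), & \text{if } x \text{ is opposite both } d \text{ and } q, \text{ where } p,b \text{ are opposite points with } x,d,q\in p^\perp\cap b^\perp,\end{cases}$$ is a well-defined collineation of the whole polar space $\Delta$ that fixes all planes through $dq$ pointwise, stabilizes all lines through either $d$ or $q$, and maps $m$ to $m'$.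
   Context: A point-line geometry is a set of points with a set of lines (subsets of the point set). Points $x,y$ on a common line are collinear, $x\perp y$ (each point is collinear to itself); $x^\perp$ is the set of points collinear to $x$; $xy$ is the unique line through distinct collinear points. A (non-degenerate) polar space is a point-line geometry in which every line has at least three points and, for every point $x$, $x^\perp$ is a proper subspace (closed under lines meeting it in at least two points, not everything) meeting every line. Singular subspaces are subspaces of pairwise collinear points. Rank $3$: the maximal singular subspaces are projective planes ("planes"). Thick: every line is contained in at least three planes. Two points are opposite if not collinear. For singular subspaces $U,V$, $\mathrm{proj}_U(V)$ is the set of points of $U$ collinear to all points of $V$. A translation (elation) of a projective plane with axis $A$ and center $c\in A$ is a collineation fixing every point of $A$ and stabilizing every line through $c$. A permutation $\eta$ with properties (i)–(iv) exists and is unique. For opposite points $p,b$, $p^\perp\cap b^\perp$ with the lines contained in it is a thick generalized quadrangle; a root elation of it corresponding to the root $(d,dq,q)$ is a collineation of the quadrangle fixing all points of $dq$ and stabilizing all its lines through $d$ or $q$; the root elation $\eta_{p,b}$ exists and is unique. A collineation is a permutation of the points inducing a permutation of the lines. *)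

theory Defs
  imports Main
begin

record 'a geometry =
  points :: "'a set"
  lines :: "'a set set"

definition point_line_geometry :: "'a geometry \<Rightarrow> bool" where
  "point_line_geometry G \<longleftrightarrow> (\<forall>l\<in>lines G. l \<subseteq> points G)"

definition collinear :: "'a geometry \<Rightarrow> 'a \<Rightarrow> 'a \<Rightarrow> bool" where
  "collinear G x y \<longleftrightarrow> x \<in> points G \<and> y \<in> points G \<and>
     (x = y \<or> (\<exists>l\<in>lines G. x \<in> l \<and> y \<in> l))"

definition perp :: "'a geometry \<Rightarrow> 'a \<Rightarrow> 'a set" where
  "perp G x = {y. collinear G x y}"

definition opposite :: "'a geometry \<Rightarrow> 'a \<Rightarrow> 'a \<Rightarrow> bool" where
  "opposite G x y \<longleftrightarrow> x \<in> points G \<and> y \<in> points G \<and> \<not> collinear G x y"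

text \<open>Only meaningful for distinct collinear points of a geometry in which
  two points lie on at most one common line; polar spaces have this property.\<close>

definition line_through :: "'a geometry \<Rightarrow> 'a \<Rightarrow> 'a \<Rightarrow> 'a set" where
  "line_through G x y = (THE l. l \<in> lines G \<and> x \<in> l \<and> y \<in> l)"

text \<open>Not expressed by \<^const>\<open>card\<close>, which is 0 on infinite sets.\<close>

definition at_least_three :: "'a set \<Rightarrow> bool" where
  "at_least_three A \<longleftrightarrow> (\<exists>x\<in>A. \<exists>y\<in>A. \<exists>z\<in>A. x \<noteq> y \<and> x \<noteq> z \<and> y \<noteq> z)"

definition subspace :: "'a geometry \<Rightarrow> 'a set \<Rightarrow> bool" where
  "subspace G S \<longleftrightarrow> S \<subseteq> points G \<and>
     (\<forall>l\<in>lines G. (\<exists>x\<in>l \<inter> S. \<exists>y\<in>l \<inter> S. x \<noteq> y) \<longrightarrow> l \<subseteq> S)"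

definition singular_subspace :: "'a geometry \<Rightarrow> 'a set \<Rightarrow> bool" where
  "singular_subspace G S \<longleftrightarrow> subspace G S \<and> (\<forall>x\<in>S. \<forall>y\<in>S. collinear G x y)"

definition maximal_singular_subspace :: "'a geometry \<Rightarrow> 'a set \<Rightarrow> bool" where
  "maximal_singular_subspace G S \<longleftrightarrow> singular_subspace G S \<and>
     (\<forall>T. singular_subspace G T \<longrightarrow> S \<subseteq> T \<longrightarrow> T = S)"

definition induced :: "'a geometry \<Rightarrow> 'a set \<Rightarrow> 'a geometry" where
  "induced G S = \<lparr>points = S, lines = {l \<in> lines G. l \<subseteq> S}\<rparr>"

definition projective_plane :: "'a geometry \<Rightarrow> bool" where
  "projective_plane G \<longleftrightarrow> point_line_geometry G \<and>
     (\<forall>x\<in>points G. \<forall>y\<in>points G. x \<noteq> y \<longrightarrow> (\<exists>!l. l \<in> lines G \<and> x \<in> l \<and> y \<in> l)) \<and>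
     (\<forall>l\<in>lines G. \<forall>k\<in>lines G. l \<noteq> k \<longrightarrow> (\<exists>!x. x \<in> l \<inter> k)) \<and>
     (\<exists>Q\<subseteq>points G. card Q = 4 \<and> (\<forall>l\<in>lines G. card (Q \<inter> l) \<le> 2))"

definition polar_space :: "'a geometry \<Rightarrow> bool" where
  "polar_space G \<longleftrightarrow> point_line_geometry G \<and>
     (\<forall>l\<in>lines G. at_least_three l) \<and>
     (\<forall>x\<in>points G. subspace G (perp G x) \<and> perp G x \<noteq> points G \<and>
        (\<forall>l\<in>lines G. perp G x \<inter> l \<noteq> {}))"

text \<open>The empty set is a singular subspace, and by Zorn's lemma every singular subspace
  lies in a maximal one; so this condition also forces a plane to exist.\<close>

definition rank_three :: "'a geometry \<Rightarrow> bool" where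
  "rank_three G \<longleftrightarrow>
     (\<forall>S. maximal_singular_subspace G S \<longrightarrow> projective_plane (induced G S))"

text \<open>The planes of a polar space of rank 3.\<close>

abbreviation plane :: "'a geometry \<Rightarrow> 'a set \<Rightarrow> bool" where
  "plane \<equiv> maximal_singular_subspace"

definition thick :: "'a geometry \<Rightarrow> bool" where
  "thick G \<longleftrightarrow> (\<forall>l\<in>lines G. at_least_three {S. plane G S \<and> l \<subseteq> S})"

definition proj :: "'a geometry \<Rightarrow> 'a set \<Rightarrow> 'a set \<Rightarrow> 'a set" where
  "proj G U V = {u \<in> U. \<forall>v\<in>V. collinear G u v}"

text \<open>Maps are total functions on the underlying type; only their values on the point set
  of the geometry at hand matter.\<close>

definition collineation :: "'a geometry \<Rightarrow> ('a \<Rightarrow> 'a) \<Rightarrow> bool" where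
  "collineation G f \<longleftrightarrow>
     bij_betw f (points G) (points G) \<and> bij_betw ((`) f) (lines G) (lines G)"

definition translation :: "'a geometry \<Rightarrow> 'a set \<Rightarrow> 'a \<Rightarrow> ('a \<Rightarrow> 'a) \<Rightarrow> bool" where
  "translation G A c f \<longleftrightarrow> A \<in> lines G \<and> c \<in> A \<and> collineation G f \<and>
     (\<forall>x\<in>A. f x = x) \<and> (\<forall>l\<in>lines G. c \<in> l \<longrightarrow> f ` l = l)"

text \<open>Root elation of a generalized quadrangle \<open>G\<close> with respect to the root \<open>(d, K, q)\<close>,
  where \<open>K\<close> is the line joining \<open>d\<close> and \<open>q\<close>.\<close>

definition root_elation ::
    "'a geometry \<Rightarrow> 'a \<Rightarrow> 'a set \<Rightarrow> 'a \<Rightarrow> ('a \<Rightarrow> 'a) \<Rightarrow> bool" where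
  "root_elation G d K q f \<longleftrightarrow> collineation G f \<and> (\<forall>x\<in>K. f x = x) \<and>
     (\<forall>l\<in>lines G. d \<in> l \<or> q \<in> l \<longrightarrow> f ` l = l)"

definition eta_map :: "'a geometry \<Rightarrow> 'a \<Rightarrow> 'a \<Rightarrow> 'a \<Rightarrow> 'a \<Rightarrow> ('a \<Rightarrow> 'a) \<Rightarrow> bool" where
  "eta_map G d q m m' \<eta> \<longleftrightarrow>
     bij_betw \<eta> (perp G d \<union> perp G q) (perp G d \<union> perp G q) \<and>
     \<eta> m = m' \<and>
     (\<forall>x\<in>perp G d \<inter> perp G q. \<eta> x = x) \<and>
     (\<forall>S. plane G S \<longrightarrow> d \<in> S \<longrightarrow> q \<notin> S \<longrightarrow>
        translation (induced G S) (proj G S (line_through G d q)) d \<eta>) \<and>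
     (\<forall>S. plane G S \<longrightarrow> q \<in> S \<longrightarrow> d \<notin> S \<longrightarrow>
        translation (induced G S) (proj G S (line_through G d q)) q \<eta>) \<and>
     (\<forall>x\<in>perp G d \<union> perp G q. \<forall>y\<in>perp G d \<union> perp G q.
        collinear G x y \<longrightarrow> collinear G (\<eta> x) (\<eta> y))"

definition eta_pb :: "'a geometry \<Rightarrow> 'a \<Rightarrow> 'a \<Rightarrow> ('a \<Rightarrow> 'a) \<Rightarrow> 'a \<Rightarrow> 'a \<Rightarrow> ('a \<Rightarrow> 'a) \<Rightarrow> bool" where
  "eta_pb G d q \<eta> p b f \<longleftrightarrow>
     root_elation (induced G (perp G p \<inter> perp G b)) d (line_through G d q) q f \<and>
     (\<forall>x\<in>perp G p \<inter> perp G b. collinear G x q \<or> collinear G x d \<longrightarrow> f x = \<eta> x)"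

definition in_plane_with :: "'a geometry \<Rightarrow> 'a \<Rightarrow> 'a set \<Rightarrow> bool" where
  "in_plane_with G x l \<longleftrightarrow> (\<exists>S. plane G S \<and> l \<subseteq> S \<and> x \<in> S)"

text \<open>\<open>phi_graph G d q \<eta> E x y\<close>: the case distinction defining \<open>\<phi>\<close> admits \<open>y\<close> as a value
  at \<open>x\<close>, with \<open>E p b\<close> in the role of the root elation belonging to \<open>p\<close> and \<open>b\<close>. In the third
  case every admissible pair \<open>p, b\<close> contributes a value, so \<open>\<phi>\<close> is well defined iff there
  is exactly one such \<open>y\<close> for each point \<open>x\<close>.\<close>

definition phi_graph ::
    "'a geometry \<Rightarrow> 'a \<Rightarrow> 'a \<Rightarrow> ('a \<Rightarrow> 'a) \<Rightarrow> ('a \<Rightarrow> 'a \<Rightarrow> 'a \<Rightarrow> 'a) \<Rightarrow> 'a \<Rightarrow> 'a \<Rightarrow> bool" where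
  "phi_graph G d q \<eta> E x y \<longleftrightarrow>
     in_plane_with G x (line_through G d q) \<and> y = x \<or>
     (collinear G x q \<or> collinear G x d) \<and> \<not> in_plane_with G x (line_through G d q) \<and> y = \<eta> x \<or>
     opposite G x d \<and> opposite G x q \<and>
       (\<exists>p b. opposite G p b \<and> {x, d, q} \<subseteq> perp G p \<inter> perp G b \<and> y = E p b x)"

definition phi ::
    "'a geometry \<Rightarrow> 'a \<Rightarrow> 'a \<Rightarrow> ('a \<Rightarrow> 'a) \<Rightarrow> ('a \<Rightarrow> 'a \<Rightarrow> 'a \<Rightarrow> 'a) \<Rightarrow> 'a \<Rightarrow> 'a" where
  "phi G d q \<eta> E x = (THE y. phi_graph G d q \<eta> E x y)"

end

theory Submission
  imports Defs
begin

text \<open>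
  Let \<open>L\<close> be the line \<open>dq\<close> and let \<open>x\<close> be opposite both \<open>d\<close> and \<open>q\<close>, collinear with the point \<open>e\<close> of \<open>L\<close>.
  If a line \<open>K\<close> through \<open>x\<close> contains no point of \<open>d\<^sup>\<bottom> \<inter> q\<^sup>\<bottom>\<close>, it meets \<open>d\<^sup>\<bottom>\<close> and \<open>q\<^sup>\<bottom>\<close> in distinct points
  \<open>z\<close> and \<open>w\<close>, and any root elation defined on \<open>K\<close> sends \<open>x\<close> to the unique point of the line \<open>\<eta>(z)\<eta>(w)\<close>
  collinear with \<open>e\<close>. So pairs \<open>(p, b)\<close> whose quadrangles share such a \<open>K\<close> give the same image of \<open>x\<close>.
  If a plane \<open>\<alpha>\<close> meets \<open>d\<^sup>\<bottom> \<inter> q\<^sup>\<bottom>\<close> in \<open>p\<close> only, then \<open>\<eta>\<close> maps its points in \<open>d\<^sup>\<bottom> \<union> q\<^sup>\<bottom>\<close> into a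
  plane \<open>\<beta>\<close>, which then contains the images of all points of \<open>\<alpha>\<close>, for every \<open>b\<close>. For \<open>x \<in> \<alpha>\<close> the images
  for \<open>b\<close> and \<open>b'\<close> thus lie on the line \<open>\<beta> \<inter> e\<^sup>\<bottom>\<close>, which also contains \<open>p\<close>; if \<open>b\<close> and \<open>b'\<close> are on a line with \<open>e\<close>,
  both images are collinear with \<open>b'\<close>, and they are equal because \<open>p\<close> is not. The two facts together
  link any two pairs. The same plane \<open>\<beta>\<close> gives collinearity of the images on lines of \<open>\<alpha>\<close> through \<open>p\<close>,
  which lie in no common quadrangle. The inverse map arises in the same way from \<open>\<eta>\<^sup>-\<^sup>1\<close> and the inverse
  root elations, so \<open>\<phi>\<close> preserves collinearity in both directions, and a line
  is the double perp of any two of its points.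
\<close>

section \<open>Polar spaces of rank three\<close>

locale rank_three_polar_space =
  fixes G :: "'a geometry"
  assumes polar: "polar_space G" and rank: "rank_three G" and thick: "thick G"
begin

abbreviation col (infix "\<sim>" 50) where "x \<sim> y \<equiv> collinear G x y"

lemma line_subset: "l \<in> lines G \<Longrightarrow> l \<subseteq> points G"
  using polar unfolding polar_space_def point_line_geometry_def by blast

lemma col_sym: "x \<sim> y \<Longrightarrow> y \<sim> x"
  unfolding collinear_def by auto

lemma col_refl: "x \<in> points G \<Longrightarrow> x \<sim> x"
  unfolding collinear_def by auto

lemma colD: "x \<sim> y \<Longrightarrow> x \<in> points G" "x \<sim> y \<Longrightarrow> y \<in> points G"
  unfolding collinear_def by auto

lemma line_col: "l \<in> lines G \<Longrightarrow> x \<in> l \<Longrightarrow> y \<in> l \<Longrightarrow> x \<sim> y"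
  unfolding collinear_def using line_subset by blast

lemma line_ex:
  assumes "x \<sim> y" "x \<noteq> y"
  obtains l where "l \<in> lines G" "x \<in> l" "y \<in> l"
  using assms unfolding collinear_def by blast

lemma perp_line:
  assumes l: "l \<in> lines G" "x \<in> l" "y \<in> l" "x \<noteq> y" and t: "t \<sim> x" "t \<sim> y" and "u \<in> l"
  shows "t \<sim> u"
proof -
  have "subspace G (perp G t)"
    using polar colD(1)[OF t(1)] unfolding polar_space_def by blast
  moreover have "\<exists>x\<in>l \<inter> perp G t. \<exists>y\<in>l \<inter> perp G t. x \<noteq> y"
    using l t unfolding perp_def by blast
  ultimately have "l \<subseteq> perp G t" using l(1) unfolding subspace_def by blast
  then show ?thesis using \<open>u \<in> l\<close> unfolding perp_def by blast
qed

lemma line_meets_perp: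
  assumes "t \<in> points G" "l \<in> lines G"
  obtains u where "u \<in> l" "t \<sim> u"
  using polar assms unfolding polar_space_def perp_def by blast

lemma line_other_point:
  assumes "l \<in> lines G"
  obtains u where "u \<in> l" "u \<noteq> x"
proof -
  have "at_least_three l" using polar assms unfolding polar_space_def by blast
  with that show thesis unfolding at_least_three_def by metis
qed

text \<open>All of \<open>X\<close> lies in its own perp, so the double perp \<open>?Q\<close>
  consists of pairwise collinear points and is a singular subspace containing \<open>X\<close>.
  Zorn's lemma, with unions of chains as bounds, yields a maximal one.\<close>

lemma clique_in_plane:
  assumes X: "X \<subseteq> points G" "\<And>x y. x \<in> X \<Longrightarrow> y \<in> X \<Longrightarrow> x \<sim> y"
  obtains S where "plane G S" "X \<subseteq> S"
proof -
  let ?P = "{y \<in> points G. \<forall>x\<in>X. x \<sim> y}"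
  let ?Q = "{z \<in> points G. \<forall>y\<in>?P. y \<sim> z}"
  let ?A = "{T. singular_subspace G T \<and> X \<subseteq> T}"
  have "X \<subseteq> ?P" using X by blast
  then have QP: "?Q \<subseteq> ?P" by blast
  have "subspace G ?Q"
    unfolding subspace_def
  proof (intro conjI ballI impI)
    fix l assume l: "l \<in> lines G" "\<exists>x\<in>l \<inter> ?Q. \<exists>y\<in>l \<inter> ?Q. x \<noteq> y"
    then obtain x y where xy: "x \<in> l" "y \<in> l" "x \<noteq> y" "x \<in> ?Q" "y \<in> ?Q" by blast
    have "u \<in> ?Q" if "u \<in> l" for u
      using perp_line[OF l(1) xy(1-3) _ _ that] xy(4,5) line_subset[OF l(1)] that by blast
    then show "l \<subseteq> ?Q" by blast
  qed blast
  then have "singular_subspace G ?Q"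
    unfolding singular_subspace_def using QP by blast
  moreover have "X \<subseteq> ?Q" using X(1) by (auto intro: col_sym)
  ultimately have "?A \<noteq> {}" by blast
  moreover have "\<Union>C \<in> ?A" if C: "C \<noteq> {}" "subset.chain ?A C" for C
  proof -
    have CA: "\<And>T. T \<in> C \<Longrightarrow> singular_subspace G T \<and> X \<subseteq> T"
      using C(2) unfolding subset.chain_def by blast
    have two: "\<exists>T\<in>C. x \<in> T \<and> y \<in> T" if "x \<in> \<Union>C" "y \<in> \<Union>C" for x y
      using that C(2) unfolding subset_chain_def by blast
    have "subspace G (\<Union>C)"
      unfolding subspace_def
    proof (intro conjI ballI impI)
      show "\<Union>C \<subseteq> points G"
        using CA unfolding singular_subspace_def subspace_def by blast
      fix l assume l: "l \<in> lines G" "\<exists>x\<in>l \<inter> \<Union>C. \<exists>y\<in>l \<inter> \<Union>C. x \<noteq> y"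
      then obtain x y where xy: "x \<in> l" "y \<in> l" "x \<noteq> y" "x \<in> \<Union>C" "y \<in> \<Union>C" by blast
      then obtain T where "T \<in> C" "x \<in> T" "y \<in> T" using two by blast
      moreover have "subspace G T" using CA \<open>T \<in> C\<close> unfolding singular_subspace_def by blast
      ultimately have "l \<subseteq> T" using l(1) xy unfolding subspace_def by blast
      then show "l \<subseteq> \<Union>C" using \<open>T \<in> C\<close> by blast
    qed
    moreover have "x \<sim> y" if xy: "x \<in> \<Union>C" "y \<in> \<Union>C" for x y
      using two[OF xy] CA unfolding singular_subspace_def by blast
    moreover have "X \<subseteq> \<Union>C" using C(1) CA by blast
    ultimately show ?thesis unfolding singular_subspace_def by blast
  qed
  ultimately obtain M where M: "M \<in> ?A" "\<forall>T\<in>?A. M \<subseteq> T \<longrightarrow> T = M"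
    using subset_Zorn_nonempty[of ?A] by meson
  then have "plane G M" unfolding maximal_singular_subspace_def by auto
  with M(1) that show thesis by blast
qed

section \<open>Planes as projective planes\<close>

lemma plane_points: "plane G S \<Longrightarrow> x \<in> S \<Longrightarrow> x \<in> points G"
  unfolding maximal_singular_subspace_def singular_subspace_def subspace_def by blast

lemma plane_col: "plane G S \<Longrightarrow> x \<in> S \<Longrightarrow> y \<in> S \<Longrightarrow> x \<sim> y"
  unfolding maximal_singular_subspace_def singular_subspace_def by blast

lemma plane_line:
  "plane G S \<Longrightarrow> l \<in> lines G \<Longrightarrow> x \<in> l \<Longrightarrow> y \<in> l \<Longrightarrow> x \<noteq> y \<Longrightarrow> x \<in> S \<Longrightarrow> y \<in> S \<Longrightarrow> l \<subseteq> S"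
  unfolding maximal_singular_subspace_def singular_subspace_def subspace_def by blast

lemma plane_maximal: "plane G S \<Longrightarrow> plane G T \<Longrightarrow> S \<subseteq> T \<Longrightarrow> S = T"
  unfolding maximal_singular_subspace_def by blast

text \<open>By maximality: \<open>S\<close> together with \<open>t\<close> is a clique, so it lies
  in a plane, which can only be \<open>S\<close>.\<close>

lemma plane_perp:
  assumes S: "plane G S" and t: "t \<in> points G" "\<And>s. s \<in> S \<Longrightarrow> t \<sim> s"
  shows "t \<in> S"
proof -
  have "insert t S \<subseteq> points G" using plane_points[OF S] t(1) by blast
  moreover have "x \<sim> y" if "x \<in> insert t S" "y \<in> insert t S" for x y
    using that t col_sym[OF t(2)] col_refl[OF t(1)] plane_col[OF S] by (elim insertE) simp_all
  ultimately obtain T where "plane G T" "insert t S \<subseteq> T" by (rule clique_in_plane)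
  then show ?thesis using plane_maximal[OF S] by blast
qed

lemma
  assumes "plane G S"
  shows plane_two_points: "x \<in> S \<Longrightarrow> y \<in> S \<Longrightarrow> x \<noteq> y \<Longrightarrow> \<exists>!l. (l \<in> lines G \<and> l \<subseteq> S) \<and> x \<in> l \<and> y \<in> l"
    and plane_two_lines: "l \<in> lines G \<Longrightarrow> l \<subseteq> S \<Longrightarrow> k \<in> lines G \<Longrightarrow> k \<subseteq> S \<Longrightarrow> l \<noteq> k \<Longrightarrow> \<exists>x. x \<in> l \<inter> k"
    and plane_quadrangle: "\<exists>Q\<subseteq>S. card Q = 4 \<and> (\<forall>l\<in>lines G. l \<subseteq> S \<longrightarrow> card (Q \<inter> l) \<le> 2)"
proof -
  let ?P = "\<lparr>points = S, lines = {l \<in> lines G. l \<subseteq> S}\<rparr>"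
  have *: "points ?P = S" "\<And>l. l \<in> lines ?P \<longleftrightarrow> l \<in> lines G \<and> l \<subseteq> S" by simp_all
  have P: "projective_plane ?P"
    using rank assms unfolding rank_three_def induced_def by blast
  then have "\<forall>x\<in>S. \<forall>y\<in>S. x \<noteq> y \<longrightarrow> (\<exists>!l. (l \<in> lines G \<and> l \<subseteq> S) \<and> x \<in> l \<and> y \<in> l)"
    unfolding projective_plane_def * by (elim conjE)
  then show "x \<in> S \<Longrightarrow> y \<in> S \<Longrightarrow> x \<noteq> y \<Longrightarrow> \<exists>!l. (l \<in> lines G \<and> l \<subseteq> S) \<and> x \<in> l \<and> y \<in> l"
    by blast
  have "\<forall>l\<in>lines ?P. \<forall>k\<in>lines ?P. l \<noteq> k \<longrightarrow> (\<exists>!x. x \<in> l \<inter> k)"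
    using P unfolding projective_plane_def by (elim conjE)
  then show "l \<in> lines G \<Longrightarrow> l \<subseteq> S \<Longrightarrow> k \<in> lines G \<Longrightarrow> k \<subseteq> S \<Longrightarrow> l \<noteq> k \<Longrightarrow> \<exists>x. x \<in> l \<inter> k"
    unfolding Ball_def *(2) by blast
  have "\<exists>Q\<subseteq>S. card Q = 4 \<and> (\<forall>l\<in>lines ?P. card (Q \<inter> l) \<le> 2)"
    using P unfolding projective_plane_def *(1) by (elim conjE)
  then show "\<exists>Q\<subseteq>S. card Q = 4 \<and> (\<forall>l\<in>lines G. l \<subseteq> S \<longrightarrow> card (Q \<inter> l) \<le> 2)"
    unfolding Ball_def *(2) by blast
qed

text \<open>Two collinear points lie in some plane; it contains both lines, and a projective plane
  has only one line on two points.\<close>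

lemma line_unique:
  assumes "l \<in> lines G" "k \<in> lines G" "x \<in> l" "y \<in> l" "x \<in> k" "y \<in> k" "x \<noteq> y"
  shows "l = k"
proof -
  have "{x, y} \<subseteq> points G" using assms line_subset by blast
  moreover have "u \<sim> v" if "u \<in> {x, y}" "v \<in> {x, y}" for u v
    using that assms line_col[OF assms(1)] by blast
  ultimately obtain S where S: "plane G S" "{x, y} \<subseteq> S" by (rule clique_in_plane)
  then have "l \<subseteq> S" "k \<subseteq> S" using plane_line[OF S(1)] assms by blast+
  then show ?thesis
    using plane_two_points[OF S(1), of x y] S(2) assms by blast
qed

lemma line_through_eqI:
  assumes "l \<in> lines G" "x \<in> l" "y \<in> l" "x \<noteq> y"
  shows "line_through G x y = l"
  unfolding line_through_def using assms by (intro the_equality) (simp_all add: line_unique[OF _ assms(1) _ _ assms(2-4)])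

lemma plane_lines_meet:
  assumes "plane G S" "l \<in> lines G" "l \<subseteq> S" "k \<in> lines G" "k \<subseteq> S"
  obtains x where "x \<in> l" "x \<in> k"
proof (cases "l = k")
  case True
  with assms(2) that show thesis using line_other_point by metis
next
  case False
  then obtain x where "x \<in> l \<inter> k" using plane_two_lines[OF assms] by blast
  with that show thesis by blast
qed

text \<open>Three points of a quadrangle other than \<open>u\<close> give two lines through
  \<open>a\<close>. If both passed through \<open>u\<close>, they would coincide and carry three
  points of the quadrangle.\<close>

lemma plane_line_avoiding:
  assumes S: "plane G S"
  obtains k where "k \<in> lines G" "k \<subseteq> S" "u \<notin> k"
proof -
  obtain Q where Q: "Q \<subseteq> S" "card Q = 4"
    and Ql: "\<And>l. l \<in> lines G \<Longrightarrow> l \<subseteq> S \<Longrightarrow> card (Q \<inter> l) \<le> 2"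
    using plane_quadrangle[OF S] by metis
  have "finite Q" using Q(2) by (metis card.infinite zero_neq_numeral)
  have "3 \<le> card (Q - {u})" using Q(2) by (simp add: card_Diff_singleton_if)
  then obtain R where R: "R \<subseteq> Q - {u}" "card R = 3" by (meson obtain_subset_with_card_n)
  then obtain a b c where "R = {a, b, c}" "a \<noteq> b" "a \<noteq> c" "b \<noteq> c"
    unfolding card_3_iff by blast
  with R have abc: "{a, b, c} \<subseteq> Q - {u}" "a \<noteq> b" "a \<noteq> c" "b \<noteq> c" by simp_all
  have no3: False if "l \<in> lines G" "l \<subseteq> S" "{a, b, c} \<subseteq> l" for l
  proof -
    have "card {a, b, c} \<le> card (Q \<inter> l)"
      using that(3) abc(1) \<open>finite Q\<close> by (intro card_mono) auto
    moreover have "card {a, b, c} = 3" using abc by auto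
    ultimately show False using Ql[OF that(1,2)] by linarith
  qed
  have "a \<in> S" "b \<in> S" "c \<in> S" using abc Q(1) by auto
  then have "a \<sim> b" "a \<sim> c" using plane_col[OF S] by auto
  then obtain l k where l: "l \<in> lines G" "a \<in> l" "b \<in> l" and k: "k \<in> lines G" "a \<in> k" "c \<in> k"
    using line_ex abc by metis
  have "l \<subseteq> S" "k \<subseteq> S"
    using plane_line[OF S] l k abc \<open>a \<in> S\<close> \<open>b \<in> S\<close> \<open>c \<in> S\<close> by blast+
  moreover have "u \<notin> l \<or> u \<notin> k"
  proof (rule ccontr)
    assume "\<not> (u \<notin> l \<or> u \<notin> k)"
    then have "l = k" using line_unique[of l k a u] l k abc(1) by blast
    then show False using no3[of l] l k \<open>l \<subseteq> S\<close> by blast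
  qed
  ultimately show thesis using that l k by blast
qed

text \<open>Each point \<open>s\<close> of \<open>S\<close> other than \<open>w\<close> lies on a
  line through \<open>w\<close>, which meets \<open>l\<close>. Being collinear with \<open>w\<close>
  and with the meeting point, \<open>t\<close> is collinear with \<open>s\<close>.\<close>

lemma plane_generated:
  assumes S: "plane G S" and l: "l \<in> lines G" "l \<subseteq> S" and w: "w \<in> S" "w \<notin> l"
    and t: "t \<sim> w" "\<And>u. u \<in> l \<Longrightarrow> t \<sim> u"
  shows "t \<in> S"
proof (rule plane_perp[OF S])
  show "t \<in> points G" using colD t(1) by blast
  fix s assume "s \<in> S"
  show "t \<sim> s"
  proof (cases "s = w")
    case False
    then obtain k where k: "k \<in> lines G" "s \<in> k" "w \<in> k"
      using line_ex plane_col[OF S \<open>s \<in> S\<close> w(1)] by metis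
    then have "k \<subseteq> S" using plane_line[OF S] False \<open>s \<in> S\<close> w(1) by blast
    then obtain n where n: "n \<in> l" "n \<in> k" using plane_lines_meet[OF S l k(1)] by metis
    then show ?thesis using perp_line[OF k(1), of n w t s] k t w by blast
  qed (use t in simp)
qed

lemma planes_eq:
  assumes S: "plane G S" and T: "plane G T" and l: "l \<in> lines G" "l \<subseteq> S" "l \<subseteq> T"
    and w: "w \<in> S" "w \<in> T" "w \<notin> l"
  shows "S = T"
proof -
  have "T \<subseteq> S" using plane_generated[OF S l(1,2) w(1,3)] plane_col[OF T] w l by blast
  then show ?thesis using plane_maximal[OF T S] by blast
qed

text \<open>Two points of \<open>S\<close> collinear with \<open>t\<close> span a line
  \<open>n\<close> in its perp; a further such point off \<open>n\<close> would generate
  \<open>S\<close> together with \<open>n\<close> and force \<open>t\<close> into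
  \<open>S\<close>.\<close>

lemma plane_inter_perp:
  assumes S: "plane G S" and t: "t \<in> points G" "t \<notin> S"
  shows "S \<inter> perp G t \<in> lines G"
proof -
  obtain l where l: "l \<in> lines G" "l \<subseteq> S" using plane_line_avoiding[OF S] by metis
  obtain u where u: "u \<in> l" "t \<sim> u" using line_meets_perp[OF t(1) l(1)] by metis
  \<comment> \<open>Avoiding \<open>u\<close> makes the second point \<open>v\<close> different from
    \<open>u\<close>.\<close>
  obtain k where k: "k \<in> lines G" "k \<subseteq> S" "u \<notin> k" using plane_line_avoiding[OF S] by metis
  obtain v where v: "v \<in> k" "t \<sim> v" using line_meets_perp[OF t(1) k(1)] by metis
  have "u \<noteq> v" "u \<in> S" "v \<in> S" using u v k l by auto
  then obtain n where n: "n \<in> lines G" "u \<in> n" "v \<in> n" using line_ex plane_col[OF S] by metis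
  have nS: "n \<subseteq> S" using plane_line[OF S] n \<open>u \<noteq> v\<close> \<open>u \<in> S\<close> \<open>v \<in> S\<close> by blast
  have nt: "t \<sim> s" if "s \<in> n" for s
    using perp_line[OF n \<open>u \<noteq> v\<close> u(2) v(2) that] .
  have "s \<in> n" if "s \<in> S" "t \<sim> s" for s
    using plane_generated[OF S n(1) nS that(1) _ that(2) nt] t(2) by blast
  then have "S \<inter> perp G t = n" using nS nt unfolding perp_def by blast
  with n show ?thesis by simp
qed

section \<open>Lines as double perps, and a criterion for collineations\<close>

lemma two_planes:
  assumes "l \<in> lines G"
  obtains S T where "plane G S" "plane G T" "l \<subseteq> S" "l \<subseteq> T" "S \<noteq> T"
proof -
  have "at_least_three {S. plane G S \<and> l \<subseteq> S}" using thick assms unfolding thick_def by blast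
  with that show thesis unfolding at_least_three_def by auto
qed

text \<open>The point \<open>t\<close> is collinear with every point of each plane through
  \<open>l\<close>, hence lies in all these planes; two distinct ones share only
  \<open>l\<close>.\<close>

lemma line_biperp:
  assumes l: "l \<in> lines G" "x \<in> l" "y \<in> l" "x \<noteq> y" and t: "t \<in> points G"
    and perp: "\<And>u. u \<sim> x \<Longrightarrow> u \<sim> y \<Longrightarrow> u \<sim> t"
  shows "t \<in> l"
proof -
  obtain S T where ST: "plane G S" "plane G T" "l \<subseteq> S" "l \<subseteq> T" "S \<noteq> T"
    by (rule two_planes[OF l(1)])
  have "t \<in> S" "t \<in> T"
  proof -
    have "t \<sim> s" if "plane G U" "l \<subseteq> U" "s \<in> U" for s U
      using perp[of s] plane_col[OF that(1,3)] that(2) l(2,3) col_sym[of s t] by blast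
    then show "t \<in> S" "t \<in> T" using plane_perp[OF _ t] ST by simp_all
  qed
  then show ?thesis using planes_eq[OF ST(1,2) l(1) ST(3,4)] ST(5) by blast
qed

text \<open>Describes a line by collinearity alone, with the quantifier bounded by
  \<open>points G\<close> so that it can be carried along a bijection of the point set.\<close>

lemma line_biperp_iff:
  assumes l: "l \<in> lines G" "x \<in> l" "y \<in> l" "x \<noteq> y" and t: "t \<in> points G"
  shows "t \<in> l \<longleftrightarrow> (\<forall>u\<in>points G. u \<sim> x \<longrightarrow> u \<sim> y \<longrightarrow> u \<sim> t)"
proof
  show "t \<in> l" if *: "\<forall>u\<in>points G. u \<sim> x \<longrightarrow> u \<sim> y \<longrightarrow> u \<sim> t"
  proof (rule line_biperp[OF l t])
    fix u assume u: "u \<sim> x" "u \<sim> y"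
    show "u \<sim> t" using * u colD(1)[OF u(1)] by blast
  qed
qed (use perp_line[OF l] in blast)

lemma collineationI:
  assumes bij: "bij_betw f (points G) (points G)"
    and pres: "\<And>x y. x \<in> points G \<Longrightarrow> y \<in> points G \<Longrightarrow> f x \<sim> f y \<longleftrightarrow> x \<sim> y"
  shows "collineation G f"
proof -
  have inj: "inj_on f (points G)" and im: "f ` points G = points G"
    using bij by (auto simp: bij_betw_def)
  have img: "f ` l = k" if l: "l \<in> lines G" "x \<in> l" "y \<in> l" "x \<noteq> y"
    and k: "k \<in> lines G" "f x \<in> k" "f y \<in> k" for l k x y
  proof -
    have xy: "x \<in> points G" "y \<in> points G" using l line_subset by blast+
    then have ne: "f x \<noteq> f y" using inj l(4) by (auto dest: inj_onD)
    have iff: "f t \<in> k \<longleftrightarrow> t \<in> l" if t: "t \<in> points G" for t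
    proof -
      have ft: "f t \<in> points G" using im t by blast
      have "f t \<in> k \<longleftrightarrow> (\<forall>u\<in>f ` points G. u \<sim> f x \<longrightarrow> u \<sim> f y \<longrightarrow> u \<sim> f t)"
        using line_biperp_iff[OF k ne ft] im by simp
      also have "\<dots> \<longleftrightarrow> (\<forall>u\<in>points G. u \<sim> x \<longrightarrow> u \<sim> y \<longrightarrow> u \<sim> t)"
        using pres xy t by auto
      also have "\<dots> \<longleftrightarrow> t \<in> l" using line_biperp_iff[OF l t] by simp
      finally show ?thesis .
    qed
    show ?thesis
    proof
      show "f ` l \<subseteq> k" using iff line_subset[OF l(1)] by blast
      show "k \<subseteq> f ` l"
      proof
        fix v assume "v \<in> k"
        then have "v \<in> f ` points G" using line_subset[OF k(1)] im by blast
        then show "v \<in> f ` l" using iff \<open>v \<in> k\<close> by blast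
      qed
    qed
  qed
  have "f ` l \<in> lines G" if l: "l \<in> lines G" for l
  proof -
    obtain x where x: "x \<in> l" using line_other_point[OF l] by blast
    obtain y where y: "y \<in> l" "y \<noteq> x" using line_other_point[OF l] by blast
    have xy: "x \<in> points G" "y \<in> points G" using x y line_subset[OF l] by blast+
    then have "f x \<noteq> f y" using inj y(2) by (auto dest: inj_onD)
    moreover have "f x \<sim> f y" using pres xy line_col[OF l x y(1)] by blast
    ultimately obtain k where "k \<in> lines G" "f x \<in> k" "f y \<in> k" by (metis line_ex)
    then show ?thesis using img[OF l x y(1)] y(2) by metis
  qed
  moreover have "k \<in> (`) f ` lines G" if k: "k \<in> lines G" for k
  proof -
    obtain x' where x': "x' \<in> k" using line_other_point[OF k] by blast
    obtain y' where y': "y' \<in> k" "y' \<noteq> x'" using line_other_point[OF k] by blast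
    have "x' \<in> f ` points G" "y' \<in> f ` points G" using x' y' line_subset[OF k] im by blast+
    then obtain x y where xy: "x \<in> points G" "y \<in> points G" "x' = f x" "y' = f y" by blast
    then have "x \<sim> y" "x \<noteq> y" using pres line_col[OF k x' y'(1)] y'(2) by auto
    then obtain l where "l \<in> lines G" "x \<in> l" "y \<in> l" by (metis line_ex)
    then have "f ` l = k" using img k x' y' xy \<open>x \<noteq> y\<close> by blast
    with \<open>l \<in> lines G\<close> show ?thesis by blast
  qed
  moreover have "inj_on ((`) f) (lines G)"
    using inj line_subset by (intro inj_onI) (metis inj_on_image_eq_iff)
  ultimately have "bij_betw ((`) f) (lines G) (lines G)" unfolding bij_betw_def by blast
  with bij show ?thesis unfolding collineation_def by blast
qed

end


section \<open>Geometry around the root\<close>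

locale polar_root = rank_three_polar_space G for G :: "'a geometry" +
  fixes d q :: 'a
  assumes dq: "d \<noteq> q" "d \<sim> q"
begin

abbreviation L where "L \<equiv> line_through G d q"

text \<open>The union of the planes through \<open>L\<close>, that is, the first case in the
  definition of \<open>\<phi>\<close>; \<open>D\<close> adds the second case and \<open>C\<close> is
  the third.\<close>

definition A where "A = {x. x \<sim> d \<and> x \<sim> q}"

definition D where "D = {x. x \<sim> d \<or> x \<sim> q}"

definition C where "C = {x \<in> points G. \<not> x \<sim> d \<and> \<not> x \<sim> q}"

text \<open>The index pairs of the root elations, seen from the root; \<open>frame_iff\<close>
  matches them with the pairs in \<open>phi_graph\<close>.\<close>

definition frame where "frame p b \<longleftrightarrow> p \<in> A \<and> b \<in> A \<and> \<not> p \<sim> b"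

definition quad where "quad p b = {x. x \<sim> p \<and> x \<sim> b}"

lemma A_D: "x \<in> A \<Longrightarrow> x \<in> D" unfolding A_def D_def by simp

lemma A_not_C: "x \<in> A \<Longrightarrow> x \<notin> C" unfolding A_def C_def by simp

lemma points_cases:
  assumes "x \<in> points G" obtains "x \<in> D" | "x \<in> C"
  using assms unfolding D_def C_def by blast

lemma L_line: "L \<in> lines G" "d \<in> L" "q \<in> L"
proof -
  obtain l where "l \<in> lines G" "d \<in> l" "q \<in> l" using line_ex dq(2,1) .
  then show "L \<in> lines G" "d \<in> L" "q \<in> L" using line_through_eqI dq(1) by auto
qed

text \<open>Together with \<open>foot_ex\<close>, this gives each point outside \<open>A\<close>
  exactly one collinear point on \<open>L\<close>, its foot \<open>e\<close>.\<close>

lemma A_if_two: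
  assumes "e \<in> L" "f \<in> L" "e \<noteq> f" "x \<sim> e" "x \<sim> f" shows "x \<in> A"
  unfolding A_def using perp_line[OF L_line(1) assms] L_line(2,3) by blast

lemma A_col_L: "x \<in> A \<Longrightarrow> u \<in> L \<Longrightarrow> x \<sim> u"
  using perp_line[OF L_line dq(1)] unfolding A_def by blast

lemma L_sub_A: "u \<in> L \<Longrightarrow> u \<in> A"
  unfolding A_def using line_col L_line by blast

lemma frame_notin_L: "frame p b \<Longrightarrow> p \<notin> L" "frame p b \<Longrightarrow> b \<notin> L"
  unfolding frame_def using A_col_L col_sym by blast+

lemma frame_sym: "frame p b \<Longrightarrow> frame b p"
  unfolding frame_def using col_sym by blast

lemma quad_sym: "quad p b = quad b p"
  unfolding quad_def by blast

lemma plane_L_sub_A: "plane G S \<Longrightarrow> L \<subseteq> S \<Longrightarrow> x \<in> S \<Longrightarrow> x \<in> A"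
  unfolding A_def using plane_col L_line(2,3) by blast

lemma A_plane:
  assumes "p \<in> A" obtains S where "plane G S" "L \<subseteq> S" "p \<in> S"
proof -
  have p: "p \<sim> u" "u \<sim> p" if "u \<in> L" for u
    using A_col_L[OF assms that] col_sym by blast+
  have "insert p L \<subseteq> points G" using p(1)[OF L_line(2)] colD(1) line_subset[OF L_line(1)] by blast
  moreover have "x \<sim> y" if "x \<in> insert p L" "y \<in> insert p L" for x y
    using that p line_col[OF L_line(1)] col_refl[OF colD(1)[OF p(1)[OF L_line(2)]]] by blast
  ultimately obtain S where "plane G S" "insert p L \<subseteq> S" by (rule clique_in_plane)
  with that show thesis by blast
qed

text \<open>If \<open>p\<close> and \<open>b\<close> were collinear, \<open>b\<close> would be
  collinear with the whole plane \<open>S\<close> generated by \<open>L\<close> and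
  \<open>p\<close>, and the two planes would coincide.\<close>

lemma planes_frame:
  assumes S: "plane G S" "L \<subseteq> S" "p \<in> S" "p \<notin> L" and T: "plane G T" "L \<subseteq> T" "b \<in> T" "b \<notin> L"
    and "S \<noteq> T"
  shows "frame p b"
proof -
  have A: "p \<in> A" "b \<in> A" using plane_L_sub_A S T by blast+
  have "\<not> p \<sim> b"
  proof
    assume "p \<sim> b"
    then have "b \<in> S"
      using plane_generated[OF S(1) L_line(1) S(2-4) col_sym] A_col_L[OF A(2)] by blast
    then show False using planes_eq[OF S(1) T(1) L_line(1) S(2) T(2)] T(3,4) \<open>S \<noteq> T\<close> by blast
  qed
  with A show ?thesis unfolding frame_def by blast
qed

section \<open>Feet on \<open>L\<close> and fibers in the planes through \<open>L\<close>\<close>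

lemma foot_ex:
  assumes "x \<in> points G" obtains e where "e \<in> L" "x \<sim> e"
  using line_meets_perp[OF assms L_line(1)] by blast

lemma fiber_line:
  assumes "x \<in> points G" "x \<notin> A" "plane G S" "L \<subseteq> S"
  shows "S \<inter> perp G x \<in> lines G"
  using plane_inter_perp[OF assms(3,1)] plane_L_sub_A assms by blast

text \<open>The line of points of \<open>S\<close> collinear with \<open>x\<close> meets
  \<open>L\<close> in the foot of \<open>x\<close> only, so any other point of it will do.\<close>

lemma fiber_ex:
  assumes x: "x \<in> points G" "x \<notin> A" and S: "plane G S" "L \<subseteq> S"
  obtains p where "p \<in> S" "p \<notin> L" "x \<sim> p"
proof -
  obtain e where e: "e \<in> L" "x \<sim> e" using foot_ex x(1) .
  obtain p where p: "p \<in> S \<inter> perp G x" "p \<noteq> e" using line_other_point[OF fiber_line[OF assms]] .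
  then have "x \<sim> p" unfolding perp_def by simp
  moreover have "p \<notin> L" using A_if_two[OF _ e(1) p(2) \<open>x \<sim> p\<close> e(2)] x(2) by blast
  ultimately show thesis using that p(1) by blast
qed

text \<open>The fiber of \<open>x\<close> in \<open>S\<close> is the line through \<open>e\<close>
  and \<open>b\<close>, and it also contains \<open>b'\<close>.\<close>

lemma fiber_col:
  assumes x: "x \<in> points G" "x \<notin> A" "x \<sim> e" "x \<sim> b" "x \<sim> b'" and e: "e \<in> L"
    and S: "plane G S" "L \<subseteq> S" "b \<in> S" "b \<notin> L" "b' \<in> S" and t: "t \<sim> e" "t \<sim> b"
  shows "t \<sim> b'"
  by (rule perp_line[OF fiber_line[OF x(1,2) S(1,2)], of e b])
    (use assms in \<open>auto simp: perp_def\<close>)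

lemma frame_ex:
  assumes "x \<in> C"
  obtains p b where "frame p b" "x \<in> quad p b"
proof -
  have x: "x \<in> points G" "x \<notin> A" using assms A_not_C unfolding C_def by blast+
  obtain S T where S: "plane G S" "L \<subseteq> S" and T: "plane G T" "L \<subseteq> T" and "S \<noteq> T"
    using two_planes[OF L_line(1)] by metis
  obtain p where p: "p \<in> S" "p \<notin> L" "x \<sim> p" using fiber_ex[OF x S] .
  obtain b where b: "b \<in> T" "b \<notin> L" "x \<sim> b" using fiber_ex[OF x T] .
  have "frame p b" using planes_frame[OF S p(1,2) T b(1,2) \<open>S \<noteq> T\<close>] .
  with p(3) b(3) that show thesis unfolding quad_def by blast
qed

lemma frame_completion:
  assumes "x \<in> C" "p \<in> A" "p \<notin> L"
  obtains b where "frame p b" "x \<sim> b"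
proof -
  have x: "x \<in> points G" "x \<notin> A" using assms(1) A_not_C unfolding C_def by blast+
  obtain S where S: "plane G S" "L \<subseteq> S" "p \<in> S" using A_plane[OF assms(2)] .
  obtain T where T: "plane G T" "L \<subseteq> T" "S \<noteq> T"
    using two_planes[OF L_line(1)] by metis
  obtain b where b: "b \<in> T" "b \<notin> L" "x \<sim> b" using fiber_ex[OF x T(1,2)] .
  show thesis
    using that planes_frame[OF S assms(3) T(1,2) b(1,2) T(3)] b(3) .
qed

section \<open>Transversal planes and lines\<close>

lemma quad_line:
  assumes "l \<in> lines G" "x \<in> l" "y \<in> l" "x \<noteq> y" "x \<in> quad p b" "y \<in> quad p b"
  shows "l \<subseteq> quad p b"
proof
  fix u assume "u \<in> l"
  have "p \<sim> x" "p \<sim> y" "b \<sim> x" "b \<sim> y" using assms(5,6) col_sym unfolding quad_def by blast+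
  then have "p \<sim> u" "b \<sim> u" using perp_line[OF assms(1-4) _ _ \<open>u \<in> l\<close>] by blast+
  then show "u \<in> quad p b" using col_sym unfolding quad_def by blast
qed

text \<open>Of two planes through the line \<open>xp\<close>, one omits the foot \<open>e\<close> of
  \<open>x\<close>. A second point \<open>a\<close> of \<open>A\<close> in that plane would put
  \<open>e\<close> in it, since \<open>e\<close> is collinear with \<open>x\<close>,
  \<open>p\<close> and \<open>a\<close>, which generate the plane.\<close>

lemma transversal_plane_ex:
  assumes x: "x \<in> C" and p: "p \<in> A" "p \<notin> L" "x \<sim> p"
  obtains \<alpha> where "plane G \<alpha>" "x \<in> \<alpha>" "p \<in> \<alpha>" "\<alpha> \<inter> A \<subseteq> {p}"
proof -
  have xd: "x \<in> points G" "\<not> x \<sim> d" using x unfolding C_def by blast+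
  obtain e where e: "e \<in> L" "x \<sim> e" using foot_ex xd(1) .
  \<comment> \<open>Such a line is contained in the perp of \<open>d\<close>, to which
    \<open>x\<close> does not belong.\<close>
  have not_line: "x \<notin> l" if "l \<in> lines G" "a \<in> l" "b \<in> l" "a \<noteq> b" "a \<in> A" "b \<in> A" for l a b
    using perp_line[OF that(1-4), of d x] that(5,6) xd(2) col_sym unfolding A_def by blast
  have "x \<noteq> p" using x p A_not_C by blast
  then obtain k where k: "k \<in> lines G" "x \<in> k" "p \<in> k" using line_ex p(3) by metis
  have "e \<noteq> p" using e(1) p(2) by blast
  then have "e \<notin> k" using not_line[OF k(1) _ k(3)] k(2) p(1) L_sub_A[OF e(1)] by blast
  obtain S T where ST: "plane G S" "plane G T" "k \<subseteq> S" "k \<subseteq> T" "S \<noteq> T"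
    using two_planes[OF k(1)] .
  then have "e \<notin> S \<or> e \<notin> T" using planes_eq[OF ST(1,2) k(1) ST(3,4)] \<open>e \<notin> k\<close> by blast
  then obtain \<alpha> where \<alpha>: "plane G \<alpha>" "k \<subseteq> \<alpha>" "e \<notin> \<alpha>" using ST by blast
  have "a = p" if a: "a \<in> \<alpha>" "a \<in> A" for a
  proof (rule ccontr)
    assume "a \<noteq> p"
    have pa: "p \<in> \<alpha>" "x \<in> \<alpha>" using k \<alpha> by blast+
    obtain n where n: "n \<in> lines G" "a \<in> n" "p \<in> n"
      using line_ex plane_col[OF \<alpha>(1) a(1) pa(1)] \<open>a \<noteq> p\<close> by metis
    have "n \<subseteq> \<alpha>" using plane_line[OF \<alpha>(1) n \<open>a \<noteq> p\<close> a(1) pa(1)] .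
    have "x \<notin> n" using not_line[OF n \<open>a \<noteq> p\<close> a(2) p(1)] .
    have "e \<sim> a" "e \<sim> p" using A_col_L a(2) p(1) e(1) col_sym by blast+
    then have "e \<sim> u" if "u \<in> n" for u using perp_line[OF n \<open>a \<noteq> p\<close> _ _ that] by blast
    then have "e \<in> \<alpha>"
      using plane_generated[OF \<alpha>(1) n(1) \<open>n \<subseteq> \<alpha>\<close> pa(2) \<open>x \<notin> n\<close> col_sym[OF e(2)]] by blast
    with \<alpha>(3) show False by blast
  qed
  then show thesis using that \<alpha> k by blast
qed

text \<open>The line is \<open>\<alpha> \<inter> perp G b\<close>. It misses \<open>p\<close>, the
  only possible point of \<open>A\<close> in \<open>\<alpha>\<close>, because \<open>p\<close> and
  \<open>b\<close> are not collinear.\<close>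

lemma transversal_line:
  assumes x: "x \<in> points G" "x \<sim> b" and f: "frame p b"
    and \<alpha>: "plane G \<alpha>" "x \<in> \<alpha>" "p \<in> \<alpha>" "\<alpha> \<inter> A \<subseteq> {p}"
  obtains K where "K \<in> lines G" "K \<subseteq> \<alpha>" "K \<subseteq> quad p b" "x \<in> K" "K \<inter> A = {}"
proof
  have pb: "\<not> p \<sim> b" "b \<in> points G" using f colD(1) unfolding frame_def A_def by blast+
  then have "b \<notin> \<alpha>" using plane_col[OF \<alpha>(1,3)] by blast
  then show "\<alpha> \<inter> perp G b \<in> lines G" using plane_inter_perp[OF \<alpha>(1) pb(2)] by blast
  show "\<alpha> \<inter> perp G b \<subseteq> quad p b"
    using plane_col[OF \<alpha>(1) _ \<alpha>(3)] col_sym unfolding quad_def perp_def by blast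
  show "x \<in> \<alpha> \<inter> perp G b" using x(2) \<alpha>(2) col_sym unfolding perp_def by blast
  have "p \<notin> perp G b" using pb(1) col_sym unfolding perp_def by blast
  then show "\<alpha> \<inter> perp G b \<inter> A = {}" using \<alpha>(4) by blast
qed blast

lemma transversal_feet:
  assumes K: "K \<in> lines G" "K \<inter> A = {}"
  obtains z w where "z \<in> K" "z \<sim> d" "w \<in> K" "w \<sim> q" "z \<noteq> w"
proof -
  have "d \<in> points G" "q \<in> points G" using colD dq(2) by blast+
  then obtain z w where zw: "z \<in> K" "d \<sim> z" "w \<in> K" "q \<sim> w"
    using line_meets_perp[OF _ K(1)] by metis
  then have "z \<sim> d" "w \<sim> q" using col_sym by blast+
  moreover have "z \<noteq> w" using calculation zw(1) K(2) unfolding A_def by blast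
  ultimately show thesis using that zw by blast
qed

text \<open>The fibers of \<open>z\<close> and \<open>w\<close> are lines of the plane
  \<open>S\<close> and meet in a point \<open>p\<close>. If \<open>p\<close> were on
  \<open>L\<close>, it would be the foot of both, but these feet are \<open>d\<close> and
  \<open>q\<close>.\<close>

lemma transversal_fiber:
  assumes K: "K \<in> lines G" "K \<inter> A = {}" and S: "plane G S" "L \<subseteq> S"
  obtains p where "p \<in> S" "p \<notin> L" "\<And>u. u \<in> K \<Longrightarrow> u \<sim> p"
proof -
  obtain z w where zw: "z \<in> K" "z \<sim> d" "w \<in> K" "w \<sim> q" "z \<noteq> w"
    using transversal_feet[OF K] .
  have A: "z \<notin> A" "w \<notin> A" using zw K(2) by blast+
  have pts: "z \<in> points G" "w \<in> points G" using zw colD(1) by blast+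
  obtain p where p: "p \<in> S \<inter> perp G z" "p \<in> S \<inter> perp G w"
    using plane_lines_meet[OF S(1) fiber_line[OF pts(1) A(1) S] _ fiber_line[OF pts(2) A(2) S]]
    by blast
  then have zp: "z \<sim> p" "w \<sim> p" unfolding perp_def by blast+
  have "p \<notin> L"
  proof
    assume "p \<in> L"
    have "p = d" using A_if_two[OF \<open>p \<in> L\<close> L_line(2) _ zp(1) zw(2)] A(1) by blast
    moreover have "p = q" using A_if_two[OF \<open>p \<in> L\<close> L_line(3) _ zp(2) zw(4)] A(2) by blast
    ultimately show False using dq(1) by simp
  qed
  moreover have "u \<sim> p" if "u \<in> K" for u
    using col_sym[OF perp_line[OF K(1) zw(1,3,5) col_sym[OF zp(1)] col_sym[OF zp(2)] that]] .
  ultimately show thesis using that p(1) by blast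
qed

lemma transversal_frame:
  assumes K: "K \<in> lines G" "K \<inter> A = {}"
  obtains p b where "frame p b" "K \<subseteq> quad p b"
proof -
  obtain S T where S: "plane G S" "L \<subseteq> S" and T: "plane G T" "L \<subseteq> T" and "S \<noteq> T"
    using two_planes[OF L_line(1)] by metis
  obtain p where p: "p \<in> S" "p \<notin> L" "\<And>u. u \<in> K \<Longrightarrow> u \<sim> p" using transversal_fiber[OF K S] by blast
  obtain b where b: "b \<in> T" "b \<notin> L" "\<And>u. u \<in> K \<Longrightarrow> u \<sim> b" using transversal_fiber[OF K T] by blast
  have "frame p b" using planes_frame[OF S p(1,2) T b(1,2) \<open>S \<noteq> T\<close>] .
  with p(3) b(3) that show thesis unfolding quad_def by blast
qed

end

section \<open>Root elations and independence of the frame\<close>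

text \<open>Chosen so that the inverses of \<open>\<eta>\<close> and \<open>E p b\<close> form such a family again.\<close>

locale root_elation_family = polar_root G d q for G :: "'a geometry" and d q +
  fixes \<eta> :: "'a \<Rightarrow> 'a" and E :: "'a \<Rightarrow> 'a \<Rightarrow> 'a \<Rightarrow> 'a"
  assumes eta_bij: "bij_betw \<eta> D D"
    and eta_fix: "x \<in> A \<Longrightarrow> \<eta> x = x"
    and eta_line: "l \<in> lines G \<Longrightarrow> d \<in> l \<or> q \<in> l \<Longrightarrow> \<eta> ` l = l"
    and eta_col: "x \<in> D \<Longrightarrow> y \<in> D \<Longrightarrow> x \<sim> y \<Longrightarrow> \<eta> x \<sim> \<eta> y"
    and E_bij: "frame p b \<Longrightarrow> bij_betw (E p b) (quad p b) (quad p b)"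
    and E_lines: "frame p b \<Longrightarrow>
      bij_betw ((`) (E p b)) {l \<in> lines G. l \<subseteq> quad p b} {l \<in> lines G. l \<subseteq> quad p b}"
    and E_eta: "frame p b \<Longrightarrow> x \<in> quad p b \<Longrightarrow> x \<in> D \<Longrightarrow> E p b x = \<eta> x"
begin

text \<open>\<open>\<eta>\<close> is injective and fixes \<open>A\<close> pointwise, so nothing else
  is mapped into \<open>A\<close>.\<close>

lemma eta_A:
  assumes "z \<in> D" "\<eta> z \<in> A" shows "z \<in> A"
proof -
  have "\<eta> (\<eta> z) = \<eta> z" using eta_fix assms(2) .
  then have "\<eta> z = z"
    using bij_betw_imp_inj_on[OF eta_bij] A_D[OF assms(2)] assms(1) by (auto dest: inj_onD)
  with assms(2) show ?thesis by simp
qed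

lemma eta_d: "z \<sim> d \<Longrightarrow> \<eta> z \<sim> d"
  and eta_q: "z \<sim> q \<Longrightarrow> \<eta> z \<sim> q"
proof -
  have A: "d \<in> A" "q \<in> A" using L_sub_A L_line by blast+
  show "z \<sim> d \<Longrightarrow> \<eta> z \<sim> d"
    using eta_col[OF _ A_D[OF A(1)], of z] eta_fix[OF A(1)] unfolding D_def by simp
  show "z \<sim> q \<Longrightarrow> \<eta> z \<sim> q"
    using eta_col[OF _ A_D[OF A(2)], of z] eta_fix[OF A(2)] unfolding D_def by simp
qed

lemma E_mem: "frame p b \<Longrightarrow> x \<in> quad p b \<Longrightarrow> E p b x \<in> quad p b"
  using E_bij by (meson bij_betwE)

lemma E_line:
  assumes "frame p b" "l \<in> lines G" "l \<subseteq> quad p b"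
  shows "E p b ` l \<in> lines G"
  using bij_betwE[OF E_lines[OF assms(1)]] assms(2,3) by blast

lemma E_col:
  assumes f: "frame p b" and "x \<in> quad p b" "y \<in> quad p b" "x \<sim> y"
  shows "E p b x \<sim> E p b y"
proof (cases "x = y")
  case True
  have "x \<in> points G" using assms(4) colD(1) by blast
  have "E p b x \<sim> p" using E_mem[OF f assms(2)] unfolding quad_def by blast
  then show ?thesis using True colD(1) col_refl by blast
next
  case False
  then obtain l where l: "l \<in> lines G" "x \<in> l" "y \<in> l" using line_ex assms(4) by metis
  then have "E p b ` l \<in> lines G" using E_line[OF f] quad_line[OF l False assms(2,3)] by blast
  then show ?thesis using line_col l by blast
qed

lemma E_col_rev:
  assumes f: "frame p b" and "x \<in> quad p b" "y \<in> quad p b" "E p b x \<sim> E p b y"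
  shows "x \<sim> y"
proof (cases "x = y")
  case True
  with assms(2) show ?thesis using colD(1) col_refl unfolding quad_def by blast
next
  case False
  have inj: "inj_on (E p b) (quad p b)" using E_bij[OF f] by (rule bij_betw_imp_inj_on)
  then have ne: "E p b x \<noteq> E p b y" using False assms(2,3) by (auto dest: inj_onD)
  then obtain k where k: "k \<in> lines G" "E p b x \<in> k" "E p b y \<in> k" using line_ex assms(4) by metis
  then have "k \<subseteq> quad p b" using quad_line[OF k ne] E_mem[OF f] assms(2,3) by blast
  with k(1) have "k \<in> (`) (E p b) ` {l \<in> lines G. l \<subseteq> quad p b}"
    using E_lines[OF f] unfolding bij_betw_def by simp
  then obtain l where l: "l \<in> lines G" "l \<subseteq> quad p b" "k = E p b ` l" by blast
  then have "x \<in> l" "y \<in> l" using k(2,3) inj assms(2,3) by (auto dest: inj_onD)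
  then show ?thesis using line_col[OF l(1)] by blast
qed

section \<open>Images of transversal lines\<close>

lemma L_quad: "frame p b \<Longrightarrow> u \<in> L \<Longrightarrow> u \<in> quad p b"
  unfolding frame_def quad_def using A_col_L col_sym by blast

lemma E_fix_L: "frame p b \<Longrightarrow> u \<in> L \<Longrightarrow> E p b u = u"
  using E_eta L_quad eta_fix A_D L_sub_A by metis

lemma E_col_L: "frame p b \<Longrightarrow> x \<in> quad p b \<Longrightarrow> u \<in> L \<Longrightarrow> x \<sim> u \<Longrightarrow> E p b x \<sim> u"
  using E_col L_quad E_fix_L by metis

lemma E_col_L_rev: "frame p b \<Longrightarrow> x \<in> quad p b \<Longrightarrow> u \<in> L \<Longrightarrow> E p b x \<sim> u \<Longrightarrow> x \<sim> u"
  using E_col_rev L_quad E_fix_L by metis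

text \<open>The elation agrees with \<open>\<eta>\<close> at \<open>z\<close> and \<open>w\<close>,
  so the image of \<open>K\<close> is the line joining \<open>\<eta> z\<close> and
  \<open>\<eta> w\<close>, whatever the frame.\<close>

lemma transversal_image:
  assumes K: "K \<in> lines G" "K \<inter> A = {}" "K \<subseteq> quad p b" and f: "frame p b"
    and z: "z \<in> K" "z \<sim> d" and w: "w \<in> K" "w \<sim> q" "z \<noteq> w"
  shows "E p b ` K \<in> lines G" "\<eta> z \<in> E p b ` K" "\<eta> w \<in> E p b ` K" "\<eta> z \<noteq> \<eta> w"
proof -
  have D: "z \<in> D" "w \<in> D" using z(2) w(2) unfolding D_def by blast+
  show "E p b ` K \<in> lines G" using E_line[OF f K(1,3)] .
  show "\<eta> z \<in> E p b ` K" "\<eta> w \<in> E p b ` K"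
    using E_eta[OF f] D z(1) w(1) K(3) by (metis imageI subsetD)+
  show "\<eta> z \<noteq> \<eta> w"
    using bij_betw_imp_inj_on[OF eta_bij] D w(3) by (auto dest: inj_onD)
qed

text \<open>The image of \<open>z\<close> keeps the foot \<open>u\<close>; a second collinear point
  on \<open>L\<close> would put \<open>\<eta> z\<close>, and then \<open>z\<close>, into
  \<open>A\<close>.\<close>

lemma eta_not_col_L:
  assumes "z \<in> D" "z \<notin> A" "z \<sim> u" "u \<in> L" "e \<in> L" "e \<noteq> u" "u = d \<or> u = q"
  shows "\<not> \<eta> z \<sim> e"
proof
  assume "\<eta> z \<sim> e"
  moreover have "\<eta> z \<sim> u" using eta_d eta_q assms(3,7) by blast
  ultimately have "\<eta> z \<in> A" using A_if_two assms(4-6) by blast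
  then show False using eta_A assms(1,2) by blast
qed

text \<open>Both images of \<open>x\<close> lie on the same line and are collinear with the foot
  \<open>e\<close> of \<open>x\<close>. If they differed, \<open>e\<close> would be collinear with
  all of that line, including \<open>\<eta> z\<close>, whose foot is \<open>d\<close>.\<close>

lemma E_agree_on_transversal:
  assumes K: "K \<in> lines G" "K \<inter> A = {}" and x: "x \<in> C" "x \<in> K"
    and f: "frame p b" "K \<subseteq> quad p b" and f': "frame p' b'" "K \<subseteq> quad p' b'"
  shows "E p b x = E p' b' x"
proof (rule ccontr)
  assume ne: "E p b x \<noteq> E p' b' x"
  obtain z w where zw: "z \<in> K" "z \<sim> d" "w \<in> K" "w \<sim> q" "z \<noteq> w"
    using transversal_feet[OF K] .
  note M = transversal_image[OF K f(2,1) zw] and M' = transversal_image[OF K f'(2,1) zw]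
  have eq: "E p b ` K = E p' b' ` K"
    using line_unique[OF M(1) M'(1) M(2,3) M'(2,3) M(4)] .
  obtain e where e: "e \<in> L" "x \<sim> e" using foot_ex x(1) unfolding C_def by blast
  have "e \<noteq> d" using e(2) x(1) unfolding C_def by blast
  have "E p b x \<sim> e" "E p' b' x \<sim> e" using E_col_L f f' x(2) e by blast+
  then have "e \<sim> E p b x" "e \<sim> E p' b' x" using col_sym by blast+
  then have "e \<sim> \<eta> z"
    using perp_line[OF M(1) _ _ ne, of e "\<eta> z"] M(2) x(2) eq by blast
  moreover have "\<not> \<eta> z \<sim> e"
    using eta_not_col_L[of z d e] zw(1,2) K(2) L_line(2) e(1) \<open>e \<noteq> d\<close> unfolding D_def by blast
  ultimately show False using col_sym by blast
qed

text \<open>\<open>E p b\<close> and \<open>E b p\<close> are separate members of the family, but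
  they act on the same quadrangle and hence share a transversal through \<open>x\<close>.\<close>

lemma E_swap:
  assumes x: "x \<in> C" "x \<in> quad p b" and f: "frame p b"
  shows "E p b x = E b p x"
proof -
  have xp: "x \<sim> p" "x \<sim> b" "x \<in> points G" using x unfolding quad_def C_def by blast+
  have "p \<in> A" using f unfolding frame_def by blast
  obtain \<alpha> where \<alpha>: "plane G \<alpha>" "x \<in> \<alpha>" "p \<in> \<alpha>" "\<alpha> \<inter> A \<subseteq> {p}"
    using transversal_plane_ex[OF x(1) \<open>p \<in> A\<close> frame_notin_L(1)[OF f] xp(1)] .
  obtain K where K: "K \<in> lines G" "K \<subseteq> \<alpha>" "K \<subseteq> quad p b" "x \<in> K" "K \<inter> A = {}"
    using transversal_line[OF xp(3,2) f \<alpha>] .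
  show ?thesis
    using E_agree_on_transversal[OF K(1,5) x(1) K(4) f K(3) frame_sym[OF f]] K(3) quad_sym by metis
qed

lemma image_plane:
  assumes x: "x \<in> C" "x \<in> \<alpha>" and p: "p \<in> A" "p \<notin> L"
    and \<alpha>: "plane G \<alpha>" "p \<in> \<alpha>" "\<alpha> \<inter> A \<subseteq> {p}"
  obtains \<beta> where "plane G \<beta>" "p \<in> \<beta>" "\<beta> \<inter> L = {}"
    "\<And>y b. y \<in> \<alpha> \<Longrightarrow> y \<in> C \<Longrightarrow> frame p b \<Longrightarrow> y \<sim> b \<Longrightarrow> E p b y \<in> \<beta>"
proof -
  have cl: "u \<sim> v" if u: "u \<in> \<eta> ` (\<alpha> \<inter> D)" and v: "v \<in> \<eta> ` (\<alpha> \<inter> D)" for u v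
    using u v by (elim imageE IntE) (simp add: eta_col plane_col[OF \<alpha>(1)])
  then have "\<eta> ` (\<alpha> \<inter> D) \<subseteq> points G" using colD(1) by blast
  then obtain \<beta> where \<beta>: "plane G \<beta>" "\<eta> ` (\<alpha> \<inter> D) \<subseteq> \<beta>"
    using cl by (rule clique_in_plane)
  have "p \<in> \<beta>" using \<beta>(2) \<alpha>(2) A_D[OF p(1)] eta_fix[OF p(1)] by force
  have line: "\<exists>K\<in>lines G. K \<subseteq> \<alpha> \<and> K \<subseteq> quad p b \<and> y \<in> K \<and> K \<inter> A = {}"
    if y: "y \<in> \<alpha>" "y \<in> C" "frame p b" "y \<sim> b" for y b
  proof -
    have "y \<in> points G" using y(2) unfolding C_def by blast
    then obtain K where "K \<in> lines G" "K \<subseteq> \<alpha>" "K \<subseteq> quad p b" "y \<in> K" "K \<inter> A = {}"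
      using transversal_line[OF _ y(4,3) \<alpha>(1) y(1) \<alpha>(2,3)] by metis
    then show ?thesis by blast
  qed
  have img: "E p b y \<in> \<beta>" if y: "y \<in> \<alpha>" "y \<in> C" "frame p b" "y \<sim> b" for y b
  proof -
    obtain K where K: "K \<in> lines G" "K \<subseteq> \<alpha>" "K \<subseteq> quad p b" "y \<in> K" "K \<inter> A = {}"
      using line[OF y] by blast
    obtain z w where zw: "z \<in> K" "z \<sim> d" "w \<in> K" "w \<sim> q" "z \<noteq> w"
      using transversal_feet[OF K(1,5)] .
    note M = transversal_image[OF K(1,5,3) y(3) zw]
    have "\<eta> z \<in> \<beta>" "\<eta> w \<in> \<beta>" using \<beta>(2) K(2) zw unfolding D_def by blast+
    then have "E p b ` K \<subseteq> \<beta>" using plane_line[OF \<beta>(1) M] by blast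
    then show ?thesis using K(4) by blast
  qed
  \<comment> \<open>One transversal in \<open>\<alpha>\<close> provides points of
    \<open>\<beta>\<close> with feet \<open>d\<close> and \<open>q\<close>; no point of
    \<open>L\<close> is collinear with both.\<close>
  obtain b where b: "frame p b" "x \<sim> b" using frame_completion[OF x(1) p] .
  obtain K where K: "K \<in> lines G" "K \<subseteq> \<alpha>" "K \<inter> A = {}"
    using line[OF x(2,1) b] by blast
  obtain z w where zw: "z \<in> K" "z \<sim> d" "w \<in> K" "w \<sim> q" "z \<noteq> w"
    using transversal_feet[OF K(1,3)] .
  have zw': "z \<in> D" "w \<in> D" "z \<notin> A" "w \<notin> A" using zw K(3) unfolding D_def by blast+
  then have \<eta>\<beta>: "\<eta> z \<in> \<beta>" "\<eta> w \<in> \<beta>" using \<beta>(2) K(2) zw by blast+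
  have "e \<notin> \<beta>" if "e \<in> L" for e
  proof (cases "e = d")
    case True
    then have "\<not> \<eta> w \<sim> e" using eta_not_col_L[OF zw'(2,4) zw(4) L_line(3) that] dq(1) by blast
    then show ?thesis using plane_col[OF \<beta>(1) \<eta>\<beta>(2)] by blast
  next
    case False
    then have "\<not> \<eta> z \<sim> e" using eta_not_col_L[OF zw'(1,3) zw(2) L_line(2) that] by blast
    then show ?thesis using plane_col[OF \<beta>(1) \<eta>\<beta>(1)] by blast
  qed
  then have "\<beta> \<inter> L = {}" by blast
  then show thesis by (rule that[OF \<beta>(1) \<open>p \<in> \<beta>\<close> _ img])
qed

text \<open>The premise \<open>sub\<close> holds when \<open>b\<close> and \<open>b'\<close> lie on
  one fiber through \<open>e\<close>. Distinct images would span
  \<open>\<beta> \<inter> perp G e\<close>, a line through \<open>p\<close>; as both images are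
  collinear with \<open>b'\<close>, so would be \<open>p\<close>.\<close>

lemma E_second_indep:
  assumes x: "x \<in> C" "x \<in> quad p b" "x \<sim> b'" "x \<sim> e" and f: "frame p b" "frame p b'"
    and e: "e \<in> L" and sub: "\<And>t. t \<sim> e \<Longrightarrow> t \<sim> b \<Longrightarrow> t \<sim> b'"
  shows "E p b x = E p b' x"
proof (rule ccontr)
  let ?y = "E p b x" and ?y' = "E p b' x"
  assume ne: "?y \<noteq> ?y'"
  have xp: "x \<sim> p" "x \<sim> b" "x \<in> points G" using x unfolding quad_def C_def by blast+
  have xq: "x \<in> quad p b'" using xp(1) x(3) unfolding quad_def by blast
  have p: "p \<in> A" "p \<notin> L" using f(1) frame_notin_L unfolding frame_def by blast+
  obtain \<alpha> where \<alpha>: "plane G \<alpha>" "x \<in> \<alpha>" "p \<in> \<alpha>" "\<alpha> \<inter> A \<subseteq> {p}"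
    using transversal_plane_ex[OF x(1) p xp(1)] .
  obtain \<beta> where \<beta>: "plane G \<beta>" "p \<in> \<beta>" "\<beta> \<inter> L = {}"
      "\<And>y b. y \<in> \<alpha> \<Longrightarrow> y \<in> C \<Longrightarrow> frame p b \<Longrightarrow> y \<sim> b \<Longrightarrow> E p b y \<in> \<beta>"
    using image_plane[OF x(1) \<alpha>(2) p \<alpha>(1,3,4)] by blast
  have y: "?y \<in> \<beta>" "?y' \<in> \<beta>" using \<beta>(4)[OF \<alpha>(2) x(1)] f xp(2) x(3) by blast+
  obtain n where n: "n \<in> lines G" "?y \<in> n" "?y' \<in> n"
    using line_ex plane_col[OF \<beta>(1) y] ne by metis
  have ye: "?y \<sim> e" "?y' \<sim> e" using E_col_L f x xq e by blast+
  have yb: "?y \<sim> b'" "?y' \<sim> b'"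
    using E_mem[OF f(1) x(2)] E_mem[OF f(2) xq] sub[OF ye(1)] unfolding quad_def by blast+
  have "e \<in> points G" "e \<notin> \<beta>" using e \<beta>(3) ye(1) colD(2) by blast+
  then have "\<beta> \<inter> perp G e \<in> lines G" using plane_inter_perp[OF \<beta>(1)] by blast
  then have "\<beta> \<inter> perp G e = n"
    using line_unique[OF _ n(1) _ _ n(2,3) ne] y col_sym[OF ye(1)] col_sym[OF ye(2)]
    unfolding perp_def by blast
  then have "p \<in> n" using \<beta>(2) col_sym[OF A_col_L[OF p(1) e]] unfolding perp_def by blast
  then have "b' \<sim> p" using perp_line[OF n ne col_sym[OF yb(1)] col_sym[OF yb(2)]] by blast
  then show False using f(2) col_sym unfolding frame_def by blast
qed

lemma E_indep:
  assumes x: "x \<in> C" "x \<in> quad p b" "x \<in> quad p' b'" and f: "frame p b" "frame p' b'"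
  shows "E p b x = E p' b' x"
proof -
  have xp: "x \<in> points G" "x \<notin> A" "x \<sim> p" "x \<sim> b" "x \<sim> p'" "x \<sim> b'"
    using x A_not_C unfolding C_def quad_def by blast+
  obtain e where e: "e \<in> L" "x \<sim> e" using foot_ex xp(1) .
  have A: "p \<in> A" "p' \<in> A" "b' \<in> A" "\<not> p' \<sim> b'" using f unfolding frame_def by blast+
  \<comment> \<open>Taking the planes of \<open>p'\<close> and \<open>b'\<close> ensures that
    \<open>r\<close> and \<open>p'\<close> lie on one fiber of \<open>x\<close>, and likewise
    \<open>s\<close> and \<open>b'\<close>.\<close>
  obtain S where S: "plane G S" "L \<subseteq> S" "p' \<in> S" using A_plane[OF A(2)] .
  obtain T where T: "plane G T" "L \<subseteq> T" "b' \<in> T" using A_plane[OF A(3)] .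
  have "S \<noteq> T" using plane_col[OF S(1,3)] T(3) A(4) by blast
  obtain \<alpha> where \<alpha>: "plane G \<alpha>" "x \<in> \<alpha>" "p \<in> \<alpha>" "\<alpha> \<inter> A \<subseteq> {p}"
    using transversal_plane_ex[OF x(1) A(1) frame_notin_L(1)[OF f(1)] xp(3)] .
  obtain K where K: "K \<in> lines G" "K \<subseteq> quad p b" "x \<in> K" "K \<inter> A = {}"
    by (rule transversal_line[OF xp(1,4) f(1) \<alpha>])
  obtain r where r: "r \<in> S" "r \<notin> L" "\<And>u. u \<in> K \<Longrightarrow> u \<sim> r"
    using transversal_fiber[OF K(1,4) S(1,2)] by blast
  obtain s where s: "s \<in> T" "s \<notin> L" "\<And>u. u \<in> K \<Longrightarrow> u \<sim> s"
    using transversal_fiber[OF K(1,4) T(1,2)] by blast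
  have L: "p' \<notin> L" "b' \<notin> L" using frame_notin_L f(2) by blast+
  have rs: "frame r s" using planes_frame[OF S(1,2) r(1,2) T(1,2) s(1,2) \<open>S \<noteq> T\<close>] .
  have rb': "frame r b'" using planes_frame[OF S(1,2) r(1,2) T L(2) \<open>S \<noteq> T\<close>] .
  have xrs: "x \<sim> r" "x \<sim> s" using r(3) s(3) K(3) by blast+
  then have q: "x \<in> quad r s" "x \<in> quad r b'" "x \<in> quad b' r" "x \<in> quad b' p'"
    using xp unfolding quad_def by blast+
  have "K \<subseteq> quad r s" using r(3) s(3) unfolding quad_def by blast
  \<comment> \<open>The frames \<open>(p, b)\<close> and \<open>(r, s)\<close> share
    \<open>K\<close>. From there one point is moved along a fiber at a time, with a swap to bring it
    into second position.\<close>
  then have "E p b x = E r s x" using E_agree_on_transversal[OF K(1,4) x(1) K(3) f(1) K(2) rs] by blast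
  also have "\<dots> = E r b' x"
    by (rule E_second_indep[OF x(1) q(1) xp(6) e(2) rs rb' e(1)
          fiber_col[OF xp(1,2) e(2) xrs(2) xp(6) e(1) T(1,2) s(1,2) T(3)]])
  also have "\<dots> = E b' r x" using E_swap[OF x(1) q(2) rb'] .
  also have "\<dots> = E b' p' x"
    by (rule E_second_indep[OF x(1) q(3) xp(5) e(2) frame_sym[OF rb'] frame_sym[OF f(2)] e(1)
          fiber_col[OF xp(1,2) e(2) xrs(1) xp(5) e(1) S(1,2) r(1,2) S(3)]])
  also have "\<dots> = E p' b' x" using E_swap[OF x(1) q(4) frame_sym[OF f(2)]] .
  finally show ?thesis .
qed

section \<open>The global collineation\<close>

lemma in_plane_with_L_iff: "in_plane_with G x L \<longleftrightarrow> x \<in> A"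
proof
  show "in_plane_with G x L \<Longrightarrow> x \<in> A"
    unfolding in_plane_with_def using plane_L_sub_A by blast
  assume "x \<in> A"
  then obtain S where "plane G S" "L \<subseteq> S" "x \<in> S" by (rule A_plane)
  then show "in_plane_with G x L" unfolding in_plane_with_def by blast
qed

lemma quad_eq: "quad p b = perp G p \<inter> perp G b"
  unfolding quad_def perp_def using col_sym by blast

lemma frame_iff: "frame p b \<longleftrightarrow> opposite G p b \<and> {d, q} \<subseteq> perp G p \<inter> perp G b"
  unfolding frame_def opposite_def A_def perp_def using colD by blast

lemma phi_graph_A: "x \<in> A \<Longrightarrow> phi_graph G d q \<eta> E x y \<longleftrightarrow> y = x"
  unfolding phi_graph_def in_plane_with_L_iff unfolding A_def opposite_def by simp

text \<open>On \<open>A\<close> the prescribed value \<open>x\<close> equals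
  \<open>\<eta> x\<close>, so the first two cases merge.\<close>

lemma phi_graph_D: "x \<in> D \<Longrightarrow> phi_graph G d q \<eta> E x y \<longleftrightarrow> y = \<eta> x"
  by (cases "x \<in> A")
    (auto simp: phi_graph_A eta_fix phi_graph_def in_plane_with_L_iff D_def opposite_def)

lemma phi_graph_C:
  assumes "x \<in> C" "frame p b" "x \<in> quad p b"
  shows "phi_graph G d q \<eta> E x y \<longleftrightarrow> y = E p b x"
proof -
  have x: "x \<notin> A" "opposite G x d" "opposite G x q" "\<not> x \<sim> d" "\<not> x \<sim> q"
    using assms(1) A_not_C dq(2) colD unfolding C_def opposite_def by blast+
  have "phi_graph G d q \<eta> E x y \<longleftrightarrow>
      (\<exists>p' b'. opposite G p' b' \<and> {x, d, q} \<subseteq> perp G p' \<inter> perp G b' \<and> y = E p' b' x)"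
    unfolding phi_graph_def in_plane_with_L_iff using x by simp
  also have "\<dots> \<longleftrightarrow> (\<exists>p' b'. frame p' b' \<and> x \<in> quad p' b' \<and> y = E p' b' x)"
    unfolding frame_iff quad_eq by (simp add: conj_ac)
  also have "\<dots> \<longleftrightarrow> y = E p b x"
    using E_indep[OF assms(1) _ assms(3) _ assms(2)] assms(2,3) by blast
  finally show ?thesis .
qed

lemma phi_well_defined:
  assumes "x \<in> points G" shows "\<exists>!y. phi_graph G d q \<eta> E x y"
  using assms
proof (cases rule: points_cases)
  case 1
  then show ?thesis using phi_graph_D by simp
next
  case 2
  obtain p b where "frame p b" "x \<in> quad p b" using frame_ex[OF 2] .
  then show ?thesis using phi_graph_C[OF 2] by simp
qed

lemma phi_D: "x \<in> D \<Longrightarrow> phi G d q \<eta> E x = \<eta> x"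
  unfolding phi_def by (rule the_equality) (simp_all add: phi_graph_D)

lemma phi_C: "x \<in> C \<Longrightarrow> frame p b \<Longrightarrow> x \<in> quad p b \<Longrightarrow> phi G d q \<eta> E x = E p b x"
  unfolding phi_def by (rule the_equality) (simp_all add: phi_graph_C)

text \<open>On each quadrangle \<open>\<phi>\<close> is the given elation, so collinear points of a
  common quadrangle cause no difficulty.\<close>

lemma phi_quad:
  assumes "frame p b" "x \<in> quad p b" shows "phi G d q \<eta> E x = E p b x"
proof -
  have "x \<in> points G" using assms(2) colD(1) unfolding quad_def by blast
  then show ?thesis
  proof (cases rule: points_cases)
    case 1
    then show ?thesis using phi_D E_eta[OF assms] by simp
  next
    case 2
    then show ?thesis using phi_C assms by blast
  qed
qed

section \<open>Preservation of collinearity\<close>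

lemma phi_col_quad:
  assumes "frame p b" "x \<in> quad p b" "y \<in> quad p b" "x \<sim> y"
  shows "phi G d q \<eta> E x \<sim> phi G d q \<eta> E y"
  using E_col[OF assms] phi_quad assms by simp

lemma phi_col_C:
  assumes x: "x \<in> C" and xy: "x \<sim> y"
  shows "phi G d q \<eta> E x \<sim> phi G d q \<eta> E y"
proof (cases "x = y")
  case True
  obtain p b where "frame p b" "x \<in> quad p b" using frame_ex[OF x] .
  then show ?thesis using phi_col_quad[of p b x x] xy True by simp
next
  case False
  have xp: "x \<in> points G" "\<not> x \<sim> d" "\<not> x \<sim> q" using x unfolding C_def by blast+
  obtain e where e: "e \<in> L" "x \<sim> e" using foot_ex xp(1) .
  obtain K where K: "K \<in> lines G" "x \<in> K" "y \<in> K" using line_ex xy False by metis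
  show ?thesis
  proof (cases "K \<inter> A = {}")
    case True
    obtain p b where f: "frame p b" "K \<subseteq> quad p b" using transversal_frame[OF K(1) True] .
    then have "x \<in> quad p b" "y \<in> quad p b" using K by blast+
    then show ?thesis using phi_col_quad[OF f(1) _ _ xy] by simp
  next
    case False
    then obtain a where a: "a \<in> K" "a \<in> A" by blast
    have xa: "x \<sim> a" using line_col[OF K(1,2) a(1)] .
    \<comment> \<open>As \<open>a\<close> is collinear with both \<open>d\<close> and
      \<open>q\<close>, it shares one of them with \<open>y\<close>. If \<open>y\<close> differed
      from \<open>a\<close>, all of \<open>K\<close>, and so \<open>x\<close>, would be collinear
      with that point.\<close>
    have not_D: "y = a" if yD: "y \<in> D"
    proof (rule ccontr)
      assume ne: "y \<noteq> a"
      obtain u where u: "y \<sim> u" "a \<sim> u" "u = d \<or> u = q"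
        using yD a(2) unfolding D_def A_def by blast
      have "u \<sim> x"
        using perp_line[OF K(1,3) a(1) ne col_sym[OF u(1)] col_sym[OF u(2)] K(2)] .
      then show False using u(3) xp col_sym by blast
    qed
    have "y \<in> points G" using xy colD(2) by blast
    then have y: "y = a \<or> y \<in> C" using not_D unfolding C_def D_def by blast
    show ?thesis
    proof (cases "a \<in> L")
      case True
      have "a = e" using A_if_two[OF True e(1) _ xa e(2)] x A_not_C by blast
      \<comment> \<open>Every quadrangle contains \<open>L\<close>, so one through \<open>x\<close>
        also contains \<open>a\<close> and hence \<open>K\<close>.\<close>
      obtain p b where f: "frame p b" "x \<in> quad p b" using frame_ex[OF x] .
      have "a \<in> quad p b" using L_quad[OF f(1) True] .
      moreover have "x \<noteq> a" using x a(2) A_not_C by blast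
      ultimately have "K \<subseteq> quad p b" using quad_line[OF K(1,2) a(1)] f(2) by blast
      then have "y \<in> quad p b" using K(3) by blast
      then show ?thesis using phi_col_quad[OF f _ xy] by simp
    next
      case False
      obtain b where b: "frame a b" "x \<sim> b" using frame_completion[OF x a(2) False] .
      have xq: "x \<in> quad a b" using xa b(2) unfolding quad_def by blast
      show ?thesis
      proof (cases "y = a")
        case True
        have "E a b x \<sim> a" using E_mem[OF b(1) xq] unfolding quad_def by blast
        then show ?thesis
          using phi_quad[OF b(1) xq] phi_D[OF A_D[OF a(2)]] eta_fix[OF a(2)] True by simp
      next
        case ya: False
        then have "y \<in> C" using y by blast
        obtain b' where b': "frame a b'" "y \<sim> b'" using frame_completion[OF \<open>y \<in> C\<close> a(2) False] .
        have yq: "y \<in> quad a b'"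
          using line_col[OF K(1,3) a(1)] b'(2) unfolding quad_def by blast
        \<comment> \<open>\<open>x\<close> and \<open>y\<close> may need different second points
          \<open>b\<close> and \<open>b'\<close>; the plane \<open>\<beta>\<close> belonging to
          \<open>\<alpha>\<close> contains both images.\<close>
        obtain \<alpha> where \<alpha>: "plane G \<alpha>" "x \<in> \<alpha>" "a \<in> \<alpha>" "\<alpha> \<inter> A \<subseteq> {a}"
          using transversal_plane_ex[OF x a(2) False xa] .
        have "x \<noteq> a" using x a(2) A_not_C by blast
        then have "y \<in> \<alpha>" using plane_line[OF \<alpha>(1) K(1,2) a(1) _ \<alpha>(2,3)] K(3) by blast
        obtain \<beta> where \<beta>: "plane G \<beta>" "a \<in> \<beta>" "\<beta> \<inter> L = {}"
            "\<And>y b. y \<in> \<alpha> \<Longrightarrow> y \<in> C \<Longrightarrow> frame a b \<Longrightarrow> y \<sim> b \<Longrightarrow> E a b y \<in> \<beta>"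
          using image_plane[OF x \<alpha>(2) a(2) False \<alpha>(1,3,4)] by blast
        have "E a b x \<in> \<beta>" "E a b' y \<in> \<beta>"
          using \<beta>(4)[OF \<alpha>(2) x b] \<beta>(4)[OF \<open>y \<in> \<alpha>\<close> \<open>y \<in> C\<close> b'] .
        then show ?thesis
          using plane_col[OF \<beta>(1)] phi_quad[OF b(1) xq] phi_quad[OF b'(1) yq] by simp
      qed
    qed
  qed
qed

lemma phi_col:
  assumes "x \<sim> y"
  shows "phi G d q \<eta> E x \<sim> phi G d q \<eta> E y"
proof -
  consider "x \<in> C" | "y \<in> C" | "x \<in> D" "y \<in> D"
    using assms colD unfolding C_def D_def by blast
  then show ?thesis
  proof cases
    case 1
    then show ?thesis using phi_col_C assms by blast
  next
    case 2
    then show ?thesis using col_sym[OF phi_col_C[OF 2 col_sym[OF assms]]] by blast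
  next
    case 3
    then show ?thesis using eta_col assms phi_D by simp
  qed
qed

section \<open>The inverse family and bijectivity\<close>

lemma eta_inj: "x \<in> D \<Longrightarrow> y \<in> D \<Longrightarrow> \<eta> x = \<eta> y \<Longrightarrow> x = y"
  using bij_betw_imp_inj_on[OF eta_bij] by (auto dest: inj_onD)

lemma line_sub_D: "l \<in> lines G \<Longrightarrow> d \<in> l \<or> q \<in> l \<Longrightarrow> l \<subseteq> D"
  unfolding D_def using line_col by blast

text \<open>\<open>\<eta>\<close> stabilizes the line \<open>l\<close> joining \<open>b\<close> and
  \<open>u\<close>, so for \<open>b \<noteq> u\<close> the point \<open>b\<close> lies on the line
  through \<open>u\<close> and \<open>\<eta> b\<close>, both collinear with
  \<open>x\<close>.\<close>

lemma eta_col_cancel: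
  assumes u: "u = d \<or> u = q" and "b \<sim> u" "x \<sim> u" "x \<sim> \<eta> b"
  shows "x \<sim> b"
proof (cases "b = u")
  case False
  obtain l where l: "l \<in> lines G" "b \<in> l" "u \<in> l" using line_ex assms(2) False by metis
  have "u \<in> A" using u L_sub_A L_line by blast
  have "\<eta> b \<in> l" using eta_line[OF l(1)] u l(2,3) by blast
  have "b \<in> D" using u assms(2) unfolding D_def by blast
  then have "\<eta> b \<noteq> u" using eta_inj[of b u] A_D eta_fix \<open>u \<in> A\<close> False by metis
  then show ?thesis using perp_line[OF l(1) \<open>\<eta> b \<in> l\<close> l(3) _ assms(4,3) l(2)] by blast
qed (use assms in simp)

lemma eta_col_rev:
  assumes ab: "a \<in> D" "b \<in> D" and col: "\<eta> a \<sim> \<eta> b"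
  shows "a \<sim> b"
proof -
  have same: "a \<sim> b" if u: "u = d \<or> u = q" "a \<sim> u" "b \<sim> u" for u
  proof -
    have "\<eta> a \<sim> u" using u(1,2) eta_d[of a] eta_q[of a] by (elim disjE) simp_all
    then have "\<eta> a \<sim> b" using eta_col_cancel[OF u(1,3) _ col] by simp
    then show ?thesis using col_sym[OF eta_col_cancel[OF u(1,2,3)]] col_sym[of "\<eta> a" b] by simp
  qed
  \<comment> \<open>Compare \<open>b\<close> with the point \<open>c\<close> of the line
    \<open>bq\<close> collinear with \<open>a\<close>: if their images differed,
    \<open>\<eta> a\<close> would be collinear with \<open>q\<close> as well as \<open>d\<close>,
    putting \<open>a\<close> into \<open>A\<close>.\<close>
  have mixed: "a \<sim> b"
    if a: "a \<in> D" "a \<notin> A" "a \<sim> d" and b: "b \<in> D" "b \<noteq> q" "b \<sim> q" and col: "\<eta> a \<sim> \<eta> b" for a b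
  proof -
    obtain l where l: "l \<in> lines G" "b \<in> l" "q \<in> l" using line_ex b(2,3) by metis
    have "a \<in> points G" using a(3) colD(1) by blast
    then obtain c where c: "c \<in> l" "a \<sim> c" using line_meets_perp[OF _ l(1)] by blast
    have D: "l \<subseteq> D" using line_sub_D[OF l(1)] l(3) by simp
    then have "\<eta> a \<sim> \<eta> c" using eta_col[OF a(1) _ c(2)] c(1) by blast
    have "\<eta> ` l = l" using eta_line[OF l(1)] l(3) by simp
    then have "\<eta> b \<in> l" "\<eta> c \<in> l" using l(2) c(1) by blast+
    have "\<eta> b = \<eta> c"
    proof (rule ccontr)
      assume "\<eta> b \<noteq> \<eta> c"
      then have "\<eta> a \<sim> q"
        using perp_line[OF l(1) \<open>\<eta> b \<in> l\<close> \<open>\<eta> c \<in> l\<close> _ col \<open>\<eta> a \<sim> \<eta> c\<close> l(3)] by simp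
      then have "\<eta> a \<in> A" using eta_d[OF a(3)] unfolding A_def by blast
      then show False using eta_A[OF a(1)] a(2) by simp
    qed
    then have "b = c" using eta_inj[OF b(1)] c(1) D by blast
    then show ?thesis using c(2) by simp
  qed
  \<comment> \<open>If one point is near \<open>d\<close> and the other near \<open>q\<close>, the
    exceptions fall under the first two cases: points of \<open>A\<close> are collinear with
    \<open>q\<close>, and \<open>q\<close> is collinear with \<open>d\<close>.\<close>
  consider "a \<sim> d" "b \<sim> d" | "a \<sim> q" "b \<sim> q"
    | "a \<sim> d" "b \<sim> q" "a \<notin> A" "b \<noteq> q" | "b \<sim> d" "a \<sim> q" "b \<notin> A" "a \<noteq> q"
    using ab col_sym[OF dq(2)] unfolding D_def A_def by blast
  then show ?thesis
  proof cases
    case 1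
    then show ?thesis using same[of d] by simp
  next
    case 2
    then show ?thesis using same[of q] by simp
  next
    case 3
    then show ?thesis using mixed[OF ab(1) 3(3,1) ab(2) 3(4,2) col] by simp
  next
    case 4
    then show ?thesis using col_sym[OF mixed[OF ab(2) 4(3,1) ab(1) 4(4,2) col_sym[OF col]]] by simp
  qed
qed

text \<open>\<open>eta_col_rev\<close> gives preservation of collinearity by the inverse of
  \<open>\<eta>\<close>. The inverses agree on \<open>D\<close> because the elations reflect
  collinearity with \<open>d\<close> and \<open>q\<close>.\<close>

lemma inverse_family:
  "root_elation_family G d q (inv_into D \<eta>) (\<lambda>p b. inv_into (quad p b) (E p b))"
proof
  note inj = bij_betw_imp_inj_on[OF eta_bij]
  show "bij_betw (inv_into D \<eta>) D D" using bij_betw_inv_into[OF eta_bij] .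
  show "inv_into D \<eta> x = x" if "x \<in> A" for x
    using inv_into_f_eq[OF inj A_D[OF that] eta_fix[OF that]] .
  show "inv_into D \<eta> ` l = l" if "l \<in> lines G" "d \<in> l \<or> q \<in> l" for l
    using inv_into_image_cancel[OF inj line_sub_D[OF that]] eta_line[OF that] by simp
  show "inv_into D \<eta> x \<sim> inv_into D \<eta> y" if "x \<in> D" "y \<in> D" "x \<sim> y" for x y
  proof (rule eta_col_rev)
    show "inv_into D \<eta> x \<in> D" "inv_into D \<eta> y \<in> D"
      using bij_betwE[OF bij_betw_inv_into[OF eta_bij]] that(1,2) by simp_all
    show "\<eta> (inv_into D \<eta> x) \<sim> \<eta> (inv_into D \<eta> y)"
      using that bij_betw_inv_into_right[OF eta_bij] by simp
  qed
  fix p b assume f: "frame p b"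
  let ?Q = "quad p b" and ?Ls = "{l \<in> lines G. l \<subseteq> quad p b}"
  note Einj = bij_betw_imp_inj_on[OF E_bij[OF f]]
  show "bij_betw (inv_into ?Q (E p b)) ?Q ?Q" using bij_betw_inv_into[OF E_bij[OF f]] .
  \<comment> \<open>The inverse of the induced map on lines is the map on lines induced by the
    inverse.\<close>
  have "inv_into ?Ls ((`) (E p b)) k = inv_into ?Q (E p b) ` k" if k: "k \<in> ?Ls" for k
  proof -
    have "k \<in> (`) (E p b) ` ?Ls" using k E_lines[OF f] unfolding bij_betw_def by simp
    then obtain l where l: "l \<in> ?Ls" "k = E p b ` l" by (rule imageE)
    have "inv_into ?Ls ((`) (E p b)) k = l"
      using inv_into_f_f[OF bij_betw_imp_inj_on[OF E_lines[OF f]] l(1)] l(2) by simp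
    moreover have "inv_into ?Q (E p b) ` k = l"
      using inv_into_image_cancel[OF Einj] l by simp
    ultimately show ?thesis by simp
  qed
  then show "bij_betw ((`) (inv_into ?Q (E p b))) ?Ls ?Ls"
    using bij_betw_inv_into[OF E_lines[OF f]]
      bij_betw_cong[of ?Ls "inv_into ?Ls ((`) (E p b))" "(`) (inv_into ?Q (E p b))"] by simp
  show "inv_into ?Q (E p b) x = inv_into D \<eta> x" if x: "x \<in> ?Q" "x \<in> D" for x
  proof -
    let ?a = "inv_into ?Q (E p b) x"
    have a: "?a \<in> ?Q" "E p b ?a = x"
      using bij_betwE[OF bij_betw_inv_into[OF E_bij[OF f]]] x(1)
        bij_betw_inv_into_right[OF E_bij[OF f] x(1)] by simp_all
    have "?a \<in> D"
      using E_col_L_rev[OF f a(1) L_line(2)] E_col_L_rev[OF f a(1) L_line(3)] a(2) x(2)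
      unfolding D_def by auto
    moreover have "\<eta> ?a = x" using E_eta[OF f a(1) calculation] a(2) by simp
    ultimately show ?thesis using inv_into_f_eq[OF inj] by simp
  qed
qed

lemma phi_points:
  assumes "x \<in> points G" shows "phi G d q \<eta> E x \<in> points G"
  using colD(1)[OF phi_col[OF col_refl[OF assms]]] .

text \<open>\<open>E p b\<close> maps its quadrangle onto itself, so one frame through
  \<open>x\<close> serves for both maps.\<close>

lemma phi_inverse:
  fixes \<psi> defines "\<psi> \<equiv> phi G d q (inv_into D \<eta>) (\<lambda>p b. inv_into (quad p b) (E p b))"
  assumes x: "x \<in> points G"
  shows "\<psi> (phi G d q \<eta> E x) = x" "phi G d q \<eta> E (\<psi> x) = x"
proof -
  interpret inv: root_elation_family G d q "inv_into D \<eta>" "\<lambda>p b. inv_into (quad p b) (E p b)"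
    by (rule inverse_family)
  have "\<psi> (phi G d q \<eta> E x) = x \<and> phi G d q \<eta> E (\<psi> x) = x"
    using x
  proof (cases rule: points_cases)
    case 1
    have "\<eta> x \<in> D" "inv_into D \<eta> x \<in> D"
      using bij_betwE[OF eta_bij] bij_betwE[OF inv.eta_bij] 1 by blast+
    then show ?thesis
      using phi_D inv.phi_D 1 bij_betw_inv_into_left[OF eta_bij] bij_betw_inv_into_right[OF eta_bij]
      unfolding \<psi>_def by simp
  next
    case 2
    obtain p b where f: "frame p b" "x \<in> quad p b" using frame_ex[OF 2] .
    note Eb = E_bij[OF f(1)]
    show ?thesis
      using phi_quad[OF f] phi_quad[OF f(1) inv.E_mem[OF f]]
        inv.phi_quad[OF f] inv.phi_quad[OF f(1) E_mem[OF f]]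
        bij_betw_inv_into_left[OF Eb f(2)] bij_betw_inv_into_right[OF Eb f(2)]
      unfolding \<psi>_def by simp
  qed
  then show "\<psi> (phi G d q \<eta> E x) = x" "phi G d q \<eta> E (\<psi> x) = x" by blast+
qed

lemma phi_collineation: "collineation G (phi G d q \<eta> E)"
proof (rule collineationI)
  let ?\<psi> = "phi G d q (inv_into D \<eta>) (\<lambda>p b. inv_into (quad p b) (E p b))"
  interpret inv: root_elation_family G d q "inv_into D \<eta>" "\<lambda>p b. inv_into (quad p b) (E p b)"
    by (rule inverse_family)
  show "bij_betw (phi G d q \<eta> E) (points G) (points G)"
    by (rule bij_betw_byWitness[where f' = ?\<psi>])
      (simp_all add: phi_inverse phi_points inv.phi_points image_subset_iff)
  show "phi G d q \<eta> E x \<sim> phi G d q \<eta> E y \<longleftrightarrow> x \<sim> y"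
    if xy: "x \<in> points G" "y \<in> points G" for x y
    using phi_col[of x y] inv.phi_col[of "phi G d q \<eta> E x" "phi G d q \<eta> E y"]
    by (auto simp: phi_inverse(1) xy)
qed

end

section \<open>From the geometric hypotheses to the elation family\<close>

theorem proposition5p5:
  fixes \<Delta> :: "'a geometry" and d q m m' :: 'a
    and \<eta> :: "'a \<Rightarrow> 'a" and E :: "'a \<Rightarrow> 'a \<Rightarrow> 'a \<Rightarrow> 'a"
  assumes "polar_space \<Delta>" and "rank_three \<Delta>" and "thick \<Delta>"
    and "d \<noteq> q" and "collinear \<Delta> d q"
    and "m \<noteq> m'" and "collinear \<Delta> m m'"
    and "\<not> collinear \<Delta> m q" and "\<not> collinear \<Delta> m' q"
    and "d \<in> line_through \<Delta> m m'"
    and "eta_map \<Delta> d q m m' \<eta>"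
    and "\<And>p b. opposite \<Delta> p b \<Longrightarrow> {d, q} \<subseteq> perp \<Delta> p \<inter> perp \<Delta> b \<Longrightarrow> eta_pb \<Delta> d q \<eta> p b (E p b)"
  shows "(\<forall>x\<in>points \<Delta>. \<exists>!y. phi_graph \<Delta> d q \<eta> E x y) \<and>
    collineation \<Delta> (phi \<Delta> d q \<eta> E) \<and>
    (\<forall>S. plane \<Delta> S \<longrightarrow> line_through \<Delta> d q \<subseteq> S \<longrightarrow> (\<forall>x\<in>S. phi \<Delta> d q \<eta> E x = x)) \<and>
    (\<forall>l\<in>lines \<Delta>. d \<in> l \<or> q \<in> l \<longrightarrow> phi \<Delta> d q \<eta> E ` l = l) \<and>
    phi \<Delta> d q \<eta> E m = m'"
proof -
  interpret polar_root \<Delta> d q using assms(1-5) by unfold_locales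
  have D_eq: "perp \<Delta> d \<union> perp \<Delta> q = D" and A_eq: "perp \<Delta> d \<inter> perp \<Delta> q = A"
    unfolding perp_def D_def A_def using col_sym by blast+
  have eta: "bij_betw \<eta> D D" "\<eta> m = m'" "\<And>x. x \<in> A \<Longrightarrow> \<eta> x = x"
      "\<And>x y. x \<in> D \<Longrightarrow> y \<in> D \<Longrightarrow> collinear \<Delta> x y \<Longrightarrow> collinear \<Delta> (\<eta> x) (\<eta> y)"
    using assms(11) unfolding eta_map_def D_eq A_eq by simp_all
  have trans: "\<exists>ax c. c \<in> S \<inter> {d, q} \<and> translation (induced \<Delta> S) ax c \<eta>"
    if S: "plane \<Delta> S" "d \<in> S \<longleftrightarrow> q \<notin> S" for S
  proof -
    have "d \<in> S \<Longrightarrow> translation (induced \<Delta> S) (proj \<Delta> S L) d \<eta>"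
      "q \<in> S \<Longrightarrow> translation (induced \<Delta> S) (proj \<Delta> S L) q \<eta>"
      using assms(11) S unfolding eta_map_def by simp_all
    then show ?thesis using S(2) by blast
  qed
  \<comment> \<open>A line inside \<open>A\<close> is fixed pointwise. Otherwise a plane through
    \<open>l\<close> contains exactly one of \<open>d\<close> and \<open>q\<close>; that point is
    the center of the translation and lies on \<open>l\<close>.\<close>
  have stab: "\<eta> ` l = l" if l: "l \<in> lines \<Delta>" "d \<in> l \<or> q \<in> l" for l
  proof (cases "l \<subseteq> A")
    case True
    then have "\<eta> x = x" if "x \<in> l" for x using eta(3) that by blast
    then show ?thesis by simp
  next
    case False
    then obtain x where x: "x \<in> l" "x \<notin> A" by blast
    obtain S where S: "plane \<Delta> S" "l \<subseteq> S"
      using clique_in_plane[OF line_subset[OF l(1)] line_col[OF l(1)]] .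
    have one: "d \<in> S \<longleftrightarrow> q \<notin> S"
      using l(2) S(2) x plane_col[OF S(1), of x d] plane_col[OF S(1), of x q]
      unfolding A_def by blast
    obtain ax c where c: "c \<in> S \<inter> {d, q}" "translation (induced \<Delta> S) ax c \<eta>"
      using trans[OF S(1) one] by blast
    have "c \<in> l" using c(1) one l(2) S(2) by blast
    then show ?thesis
      using c(2) l(1) S(2) unfolding translation_def induced_def by simp
  qed
  have E: "bij_betw (E p b) (quad p b) (quad p b) \<and>
      bij_betw ((`) (E p b)) {l \<in> lines \<Delta>. l \<subseteq> quad p b} {l \<in> lines \<Delta>. l \<subseteq> quad p b} \<and>
      (\<forall>x\<in>quad p b. x \<in> D \<longrightarrow> E p b x = \<eta> x)" if "frame p b" for p b
  proof -
    have pb: "collinear \<Delta> p d" "collinear \<Delta> p q" "collinear \<Delta> b d" "collinear \<Delta> b q" "\<not> collinear \<Delta> p b"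
      using that unfolding frame_def A_def by simp_all
    have "opposite \<Delta> p b" "{d, q} \<subseteq> perp \<Delta> p \<inter> perp \<Delta> b"
      using pb colD(1)[OF pb(1)] colD(1)[OF pb(3)] unfolding opposite_def perp_def by simp_all
    then have "eta_pb \<Delta> d q \<eta> p b (E p b)" by (rule assms(12))
    moreover have "perp \<Delta> p \<inter> perp \<Delta> b = quad p b"
      unfolding quad_def perp_def using col_sym by blast
    ultimately show ?thesis
      unfolding eta_pb_def root_elation_def collineation_def induced_def D_def by simp
  qed
  interpret root_elation_family \<Delta> d q \<eta> E
    by unfold_locales (use eta stab E in simp_all)
  have "phi \<Delta> d q \<eta> E x = x" if "plane \<Delta> S" "L \<subseteq> S" "x \<in> S" for S x
    using plane_L_sub_A[OF that] phi_D A_D eta_fix by simp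
  moreover have "phi \<Delta> d q \<eta> E ` l = l" if l: "l \<in> lines \<Delta>" "d \<in> l \<or> q \<in> l" for l
  proof -
    have "phi \<Delta> d q \<eta> E ` l = \<eta> ` l"
      using line_sub_D[OF l] phi_D by (intro image_cong) auto
    then show ?thesis using stab[OF l] by simp
  qed
  moreover have "phi \<Delta> d q \<eta> E m = m'"
  proof -
    obtain l where l: "l \<in> lines \<Delta>" "m \<in> l" "m' \<in> l" using line_ex assms(6,7) by metis
    then have "d \<in> l" using line_through_eqI[OF l assms(6)] assms(10) by simp
    then show ?thesis using phi_D[of m] line_sub_D[OF l(1)] l(2) eta(2) by auto
  qed
  ultimately show ?thesis using phi_well_defined phi_collineation by (intro conjI ballI allI impI)
qed

end
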